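(* Let the basis functions of the random polynomials $\Phi_n$ be orthonormal polynomials on the unit circle $\{\varphi_j\}_{j=0}^\infty$ belonging to the Szegő class with weight $W$, let $D$ be the associated Szegő function, and let $v\in\mathbb{C}$. Then locally uniformly for $|z|<1$, $$\lim_{n\to\infty}\rho_{n,v}(z)=\frac1\pi\left(\frac{1}{(1-|z|^2)^2}+(1-|z|^2)\,|vD(z)|^2\left|\frac{z}{1-|z|^2}-\frac{\overline{D'(z)}}{\overline{D(z)}}\right|^2\right)\exp\left[-(1-|z|^2)\,|vD(z)|^2\right].$$
   Context: $\{\varphi_j\}_{j=0}^\infty$ are the orthonormal polynomials on the unit circle $\mathbb{T}$ with respect to a probability Borel measure $\mu$: $\deg\varphi_j=j$, positive leading coefficient, $\int_{\mathbb{T}}\varphi_j(e^{i\theta})\overline{\varphi_k(e^{i\theta})}\,d\mu(e^{i\theta})=\delta_{jk}$; in particular $\varphi_0=1$. They belong to the Szegő class if $\mu$ is absolutely continuous with respect to arc length, $d\mu=\frac{1}{2\pi}W(\theta)\,d\theta$, where the weight $W\ge0$ is measurable on $[-\pi,\pi]$ and the integrals $\int_{-\pi}^{\pi}W(\theta)\,d\theta$ (positive) and $\int_{-\pi}^{\pi}|\log W(\theta)|\,d\theta$ both exist (are finite). The Szegő function is $$D(\xi)=\exp\left[\frac{1}{4\pi}\int_{-\pi}^{\pi}\log W(\theta)\,\frac{1+\xi e^{-i\theta}}{1-\xi e^{-i\theta}}\,d\theta\right],\qquad|\xi|<1,$$ which is analytic and nonzero in $|\xi|<1$ with $D(0)>0$.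 The random polynomial is $\Phi_n(z)=\sum_{j=0}^n\eta_j\varphi_j(z)$ with $\eta_j$ i.i.d. standard complex normal. With $K_n(z,w)=\sum_{j=0}^n\varphi_j(z)\overline{\varphi_j(w)}$ and $K_n^{(k,l)}(z,w)=\sum_{j=0}^n\varphi_j^{(k)}(z)\overline{\varphi_j^{(l)}(w)}$ (superscripts $(k),(l)$ denoting derivatives), the density $\rho_{n,v}$ of the expected number of roots of $\Phi_n(z)=v$ is the function $$\rho_{n,v}(z)=\frac1\pi\left[\frac{K_n^{(1,1)}(z,z)}{K_n(z,z)}-\frac{|K_n^{(0,1)}(z,z)|^2}{K_n(z,z)^2}\left(1-\frac{|v|^2}{K_n(z,z)}\right)\right]\exp\left(-\frac{|v|^2}{K_n(z,z)}\right).$$ *)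

theory Defs
  imports "HOL-Probability.Probability" "HOL-Computational_Algebra.Polynomial"
begin

definition borel_prob_on_circle :: "complex measure \<Rightarrow> bool" where
  "borel_prob_on_circle \<mu> \<longleftrightarrow>
     prob_space \<mu> \<and> sets \<mu> = sets (restrict_space borel (sphere 0 1))"

definition orthonormal_polys :: "complex measure \<Rightarrow> (nat \<Rightarrow> complex poly) \<Rightarrow> bool" where
  "orthonormal_polys \<mu> \<phi> \<longleftrightarrow>
     (\<forall>j. degree (\<phi> j) = j) \<and>
     (\<forall>j. \<exists>c::real. c > 0 \<and> lead_coeff (\<phi> j) = complex_of_real c) \<and>
     (\<forall>j k. (LINT x|\<mu>. poly (\<phi> j) x * cnj (poly (\<phi> k) x)) = (if j = k then 1 else 0))"

text \<open>Finiteness of the integral of \<open>|log W|\<close>, where \<open>log 0\<close> is \<open>-\<infinity>\<close>, includes that \<open>W\<close> is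
  positive almost everywhere. Since \<^term>\<open>ln (0::real) = 0\<close> here, that has to be stated separately.
  The last conjunct says that \<open>\<mu>\<close> is \<open>W(\<theta>)/(2\<pi>) d\<theta>\<close>, carried to the circle by \<^const>\<open>cis\<close>.\<close>

definition szego_class :: "complex measure \<Rightarrow> (real \<Rightarrow> real) \<Rightarrow> bool" where
  "szego_class \<mu> W \<longleftrightarrow>
     W \<in> borel_measurable (lebesgue_on {-pi..pi}) \<and>
     (\<forall>\<theta>\<in>{-pi..pi}. W \<theta> \<ge> 0) \<and>
     integrable (lebesgue_on {-pi..pi}) W \<and>
     (LINT \<theta>|lebesgue_on {-pi..pi}. W \<theta>) > 0 \<and>
     (AE \<theta> in lebesgue_on {-pi..pi}. W \<theta> > 0) \<and>
     integrable (lebesgue_on {-pi..pi}) (\<lambda>\<theta>. \<bar>ln (W \<theta>)\<bar>) \<and>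
     \<mu> = distr (density (lebesgue_on {-pi..pi}) (\<lambda>\<theta>. ennreal (W \<theta> / (2 * pi))))
              (restrict_space borel (sphere 0 1)) cis"

definition szego_function :: "(real \<Rightarrow> real) \<Rightarrow> complex \<Rightarrow> complex" where
  "szego_function W \<xi> =
     exp (complex_of_real (1 / (4 * pi)) *
       (LINT \<theta>|lebesgue_on {-pi..pi}.
          complex_of_real (ln (W \<theta>)) * ((1 + \<xi> * cis (-\<theta>)) / (1 - \<xi> * cis (-\<theta>)))))"

definition kernel_deriv ::
    "(nat \<Rightarrow> complex poly) \<Rightarrow> nat \<Rightarrow> nat \<Rightarrow> nat \<Rightarrow> complex \<Rightarrow> complex \<Rightarrow> complex" where
  "kernel_deriv \<phi> k l n z w =
     (\<Sum>j=0..n. poly ((pderiv ^^ k) (\<phi> j)) z * cnj (poly ((pderiv ^^ l) (\<phi> j)) w))"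

abbreviation kernel :: "(nat \<Rightarrow> complex poly) \<Rightarrow> nat \<Rightarrow> complex \<Rightarrow> complex \<Rightarrow> complex" where
  "kernel \<phi> \<equiv> kernel_deriv \<phi> 0 0"

lemma kernel_deriv_diagonal_real:
  "complex_of_real (Re (kernel_deriv \<phi> k k n z z)) = kernel_deriv \<phi> k k n z z"
  by (simp add: kernel_deriv_def complex_mult_cnj complex_eq_iff)

text \<open>The diagonal values \<open>K\<^sub>n(z,z)\<close> and \<open>K\<^sub>n\<close>'s \<open>(1,1)\<close> derivative at \<open>(z,z)\<close> are real, so that
  \<^const>\<open>Re\<close> below only changes the type. The density is that of the expected number of solutions of
  \<open>\<Phi>\<^sub>n(z) = v\<close>, where \<open>\<Phi>\<^sub>n = \<Sum>\<^sub>j \<eta>\<^sub>j \<phi>\<^sub>j\<close> (\<open>j \<le> n\<close>) has i.i.d. standard complex normal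
  coefficients \<open>\<eta>\<^sub>j\<close>.\<close>

definition root_density ::
    "(nat \<Rightarrow> complex poly) \<Rightarrow> nat \<Rightarrow> complex \<Rightarrow> complex \<Rightarrow> real" where
  "root_density \<phi> n v z =
     1 / pi *
     (Re (kernel_deriv \<phi> 1 1 n z z) / Re (kernel \<phi> n z z)
      - (cmod (kernel_deriv \<phi> 0 1 n z z))\<^sup>2 / (Re (kernel \<phi> n z z))\<^sup>2
        * (1 - (cmod v)\<^sup>2 / Re (kernel \<phi> n z z)))
     * exp (- ((cmod v)\<^sup>2 / Re (kernel \<phi> n z z)))"

definition locally_uniform_limit ::
    "complex set \<Rightarrow> (nat \<Rightarrow> complex \<Rightarrow> real) \<Rightarrow> (complex \<Rightarrow> real) \<Rightarrow> bool" where
  "locally_uniform_limit S f g \<longleftrightarrow>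
     (\<forall>z\<in>S. \<exists>U. open U \<and> z \<in> U \<and> uniform_limit (U \<inter> S) f g sequentially)"

end

theory Submission
  imports Defs "HOL-Complex_Analysis.Complex_Analysis"
    "HOL-Computational_Algebra.Fundamental_Theorem_Algebra"
begin

text \<open>
  On the circle the boundary values of the Szego function satisfy \<open>|D|\<^sup>2 = W\<close>, so multiplication by \<open>D\<close>
  carries the closure of the polynomials in \<open>L\<^sup>2(\<mu>)\<close> into the Hardy space of the disc. This closure
  therefore has the reproducing kernel

    \<open>K(z, w) = 1 / ((1 - z * cnj w) * D z * cnj (D w))\<close>,

  and as \<open>K\<^sub>n\<close> is the reproducing kernel of the polynomials of degree at most \<open>n\<close>, it should converge to
  \<open>K\<close>. The convergence is locally uniform in both variables, so Cauchy's estimate lets it pass to the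
  derivatives (\<open>bidisc_limit_deriv\<close>). The density is a fixed continuous function of \<open>K\<^sub>n\<close> and of its
  derivatives of orders \<open>(0,1)\<close> and \<open>(1,1)\<close> on the diagonal, and putting in \<open>K\<close> and its derivatives
  gives the limit. The term \<open>1 / (1 - |z|\<^sup>2)\<^sup>2\<close> is the mixed second derivative of \<open>log K(z, z)\<close>, to which
  the factors \<open>D\<close> and \<open>cnj D\<close> contribute nothing.

  The convergence of \<open>K\<^sub>n\<close> to \<open>K\<close> is proved without boundary values of \<open>D\<close>, from two estimates that meet.

  Upper bound (\<open>polynomial_bound\<close>): the squared norm of a polynomial \<open>p\<close> in \<open>L\<^sup>2(\<mu>)\<close> is at least
  \<open>(1 - |z|\<^sup>2) * |p z * D z|\<^sup>2\<close>, which says that \<open>K\<^sub>n(z, z) \<le> K(z, z)\<close>. For \<open>p\<close> without zeros in the closed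
  disc this is Jensen's inequality for the exponential and the Poisson measure at \<open>z\<close>, because the
  Poisson integral of \<open>log |p|\<^sup>2\<close> is \<open>log |p z|\<^sup>2\<close> and that of \<open>log W\<close> is \<open>log |D z|\<^sup>2\<close>. Other polynomials
  reduce to this case: reflecting zeros in the circle leaves \<open>|p|\<close> unchanged on the circle and only
  enlarges it inside.

  Trial polynomials (\<open>kernel_trial_polys\<close>): \<open>log W\<close> is approximated in mean by the real part of a
  polynomial \<open>Q\<close> that is real at the origin. The weight \<open>exp (Re Q)\<close> has the zero-free entire function
  \<open>exp (Q / 2)\<close> for its Szego function. With a polynomial \<open>s\<close> close to \<open>exp (- Q / 2)\<close> on the closed
  disc, the polynomials \<open>cnj (s w) * s z * (\<Sum>k<n. (z * cnj w) ^ k)\<close> in \<open>z\<close> are close to \<open>K(z, w)\<close>, and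
  their squared norms exceed \<open>K(w, w)\<close> only slightly.

  The two combine through the identity \<open>\<parallel>p - K\<^sub>n(\<cdot>, w)\<parallel>\<^sup>2 = \<parallel>p\<parallel>\<^sup>2 - 2 * Re (p w) + K\<^sub>n(w, w)\<close> for \<open>p\<close> of
  degree at most \<open>n\<close> (\<open>poly_minus_kernel\<close>): for a trial polynomial the right-hand side is at most about
  \<open>K(w, w) - 2 * K(w, w) + K(w, w) = 0\<close>.
\<close>

section \<open>Circle integrals and the Schwarz formula\<close>

abbreviation arc_measure :: "real measure" where
  "arc_measure \<equiv> lebesgue_on {-pi..pi}"

lemma integrable_arc_circle:
  fixes f :: "complex \<Rightarrow> 'a::euclidean_space"
  assumes "continuous_on (sphere 0 1) f"
  shows "integrable arc_measure (\<lambda>\<theta>. f (cis \<theta>))"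
  by (rule continuous_imp_integrable_real, rule continuous_on_compose2[OF assms])
     (auto intro!: continuous_intros)

text \<open>Cauchy's integral formula on the unit circle, with the arc measured from \<open>-pi\<close> to \<open>pi\<close>. The
  contour in the proof runs over \<open>[0, 2 pi]\<close>; applying the formula to \<open>z \<mapsto> F (-z)\<close> rotates it by half a
  turn and so avoids any periodicity argument.\<close>
lemma circle_Cauchy_integral:
  assumes hol: "F holomorphic_on ball 0 \<rho>" and "\<rho> > 1" and z: "norm z < 1"
  shows "(LINT \<theta>|arc_measure. F (cis \<theta>) * (cis \<theta> / (cis \<theta> - z))) = 2 * of_real pi * F z"
proof -
  define G where "G = (\<lambda>z. F (-z))"
  have sub: "cball (0::complex) 1 \<subseteq> ball 0 \<rho>" using \<open>\<rho> > 1\<close> by auto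
  have G: "G holomorphic_on ball 0 \<rho>"
    unfolding G_def using hol
    by (intro holomorphic_on_compose_gen[of uminus _ F "ball 0 \<rho>", unfolded o_def])
       (auto intro!: holomorphic_intros)
  have "((\<lambda>u. G u / (u - (-z))) has_contour_integral (2 * of_real pi * \<i> * G (-z))) (circlepath 0 1)"
    using z \<open>\<rho> > 1\<close>
    by (intro Cauchy_integral_circlepath holomorphic_on_imp_continuous_on holomorphic_on_subset[OF G])
       auto
  hence "((\<lambda>t. G (0 + complex_of_real 1 * cis t) / (0 + complex_of_real 1 * cis t - (-z))
            * complex_of_real 1 * \<i> * cis t) has_integral (2 * of_real pi * \<i> * G (-z))) {0..2*pi}"
    unfolding circlepath_def by (subst (asm) has_contour_integral_part_circlepath_iff) auto
  hence "((\<lambda>t. \<i> * (G (cis t) * (cis t / (cis t + z)))) has_integral (\<i> * (2 * of_real pi * G (-z)))) {0..2*pi}"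
    by (simp add: mult_ac)
  hence "((\<lambda>t. - \<i> * (\<i> * (G (cis t) * (cis t / (cis t + z))))) has_integral
           (- \<i> * (\<i> * (2 * of_real pi * G (-z))))) {0..2*pi}"
    by (rule has_integral_mult_right)
  hence "((\<lambda>t. G (cis t) * (cis t / (cis t + z))) has_integral (2 * of_real pi * G (-z))) {0..2*pi}"
    by simp
  hence "((\<lambda>t. G (cis (t + pi)) * (cis (t + pi) / (cis (t + pi) + z))) has_integral
           (2 * of_real pi * G (-z))) {-pi..pi}"
    using has_integral_affinity[of "\<lambda>t. G (cis t) * (cis t / (cis t + z))" _ 0 "2*pi" 1 pi] by simp
  moreover have "G (cis (t + pi)) * (cis (t + pi) / (cis (t + pi) + z)) = F (cis t) * (cis t / (cis t - z))" for t
  proof -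
    have "cis (t + pi) = - cis t" by (simp flip: cis_mult)
    moreover have "- cis t / (- cis t + z) = cis t / (cis t - z)"
      using minus_divide_divide[of "cis t" "cis t - z"] by simp
    ultimately show ?thesis by (simp add: G_def)
  qed
  ultimately have 1: "((\<lambda>t. F (cis t) * (cis t / (cis t - z))) has_integral (2 * of_real pi * F z)) {-pi..pi}"
    unfolding G_def by simp
  have "continuous_on (sphere 0 1) F"
    using \<open>\<rho> > 1\<close> by (intro holomorphic_on_imp_continuous_on holomorphic_on_subset[OF hol]) auto
  hence "continuous_on (sphere 0 1) (\<lambda>s. F s * (s / (s - z)))"
    using z by (auto intro!: continuous_intros)
  from integrable_arc_circle[OF this]
  have "((\<lambda>t. F (cis t) * (cis t / (cis t - z))) has_integral
          (LINT \<theta>|arc_measure. F (cis \<theta>) * (cis \<theta> / (cis \<theta> - z)))) {-pi..pi}"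
    by (intro has_integral_integral_lebesgue_on) auto
  thus ?thesis using 1 by (rule has_integral_unique)
qed

lemma circle_mean_value:
  assumes "F holomorphic_on ball 0 \<rho>" and "\<rho> > 1"
  shows "(LINT \<theta>|arc_measure. F (cis \<theta>)) = 2 * of_real pi * F 0"
  using circle_Cauchy_integral[OF assms, of 0] by simp

definition schwarz_kernel :: "complex \<Rightarrow> real \<Rightarrow> complex" where
  "schwarz_kernel z \<theta> = (1 + z * cis (-\<theta>)) / (1 - z * cis (-\<theta>))"

text \<open>The Poisson kernel of the disc, in the form whose denominator is the modulus of a function of
  \<open>cis \<theta>\<close> that is holomorphic and zero-free near the closed disc.\<close>
definition poisson_kernel :: "complex \<Rightarrow> real \<Rightarrow> real" where
  "poisson_kernel z \<theta> = (1 - (cmod z)\<^sup>2) / (cmod (1 - cnj z * cis \<theta>))\<^sup>2"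

text \<open>The factor \<open>1 / (4 pi)\<close>, half of the usual normalisation, is the one of the exponent in the
  Szego function. So twice the real part is the Poisson integral.\<close>
definition herglotz :: "(real \<Rightarrow> real) \<Rightarrow> complex \<Rightarrow> complex" where
  "herglotz u z = complex_of_real (1 / (4 * pi)) *
     (LINT \<theta>|arc_measure. complex_of_real (u \<theta>) * schwarz_kernel z \<theta>)"

lemma szego_function_eq: "szego_function W z = exp (herglotz (\<lambda>\<theta>. ln (W \<theta>)) z)"
  by (simp add: szego_function_def herglotz_def schwarz_kernel_def)

lemma norm_one_minus_ge:
  fixes z s :: complex
  assumes "norm z \<le> r" "norm s \<le> 1"
  shows "1 - r \<le> norm (1 - z * s)"
proof -
  have "norm (z * s) \<le> r * 1"
    unfolding norm_mult using assms by (intro mult_mono) (auto intro: order_trans[OF norm_ge_zero])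
  thus ?thesis using norm_triangle_ineq2[of 1 "z * s"] by simp
qed

lemma schwarz_kernel_bound:
  assumes "norm z \<le> r" "r < 1"
  shows "norm (schwarz_kernel z \<theta>) \<le> 2 / (1 - r)"
proof -
  have r: "norm (z * cis (-\<theta>)) \<le> 1" using assms by (simp add: norm_mult)
  have "norm (1 + z * cis (-\<theta>)) \<le> 2"
    using norm_triangle_ineq[of 1 "z * cis (-\<theta>)"] r by simp
  moreover have "1 - r \<le> norm (1 - z * cis (-\<theta>))"
    by (rule norm_one_minus_ge) (use assms in auto)
  ultimately show ?thesis
    unfolding schwarz_kernel_def norm_divide using assms by (intro frac_le) auto
qed

lemma one_minus_mult_nz:
  fixes z s :: complex
  assumes "norm z < 1" "norm s \<le> 1"
  shows "1 - z * s \<noteq> 0"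
  using norm_one_minus_ge[of z "norm z" s] assms by auto

lemma schwarz_kernel_continuous:
  assumes "norm z < 1"
  shows "continuous_on A (schwarz_kernel z)"
  unfolding schwarz_kernel_def using one_minus_mult_nz[OF assms]
  by (auto intro!: continuous_intros)

lemma Re_schwarz_kernel:
  assumes "norm z < 1"
  shows "Re (schwarz_kernel z \<theta>) = poisson_kernel z \<theta>"
proof -
  define x where "x = z * cis (-\<theta>)"
  have nx: "cmod x = cmod z" by (simp add: x_def norm_mult)
  have "Re ((1 + x) / (1 - x)) = Re ((1 + x) * cnj (1 - x)) / (cmod (1 - x))\<^sup>2"
    by (simp add: Re_complex_div_gt_0 complex_div_cnj[of "1 + x" "1 - x"] Re_divide_of_real flip: of_real_power)
  also have "Re ((1 + x) * cnj (1 - x)) = 1 - (cmod x)\<^sup>2"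
    unfolding cmod_power2 by (simp add: algebra_simps power2_eq_square)
  also have "cmod (1 - x) = cmod (cnj (1 - x))" by (rule complex_mod_cnj[symmetric])
  also have "cnj (1 - x) = 1 - cnj z * cis \<theta>" by (simp add: x_def cis_cnj)
  finally show ?thesis by (simp add: schwarz_kernel_def poisson_kernel_def x_def[symmetric] nx)
qed

lemma poisson_kernel_pos:
  assumes "norm z < 1"
  shows "poisson_kernel z \<theta> > 0"
proof -
  have "1 - cnj z * cis \<theta> \<noteq> 0" using one_minus_mult_nz[of "cnj z" "cis \<theta>"] assms by simp
  moreover have "(cmod z)\<^sup>2 < 1" using assms by (simp add: abs_square_less_1)
  ultimately show ?thesis unfolding poisson_kernel_def by simp
qed

lemma integrable_mult_continuous:
  fixes u :: "real \<Rightarrow> 'a::{real_normed_field,euclidean_space}" and k :: "real \<Rightarrow> 'a"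
  assumes u: "integrable arc_measure u" and k: "continuous_on {-pi..pi} k"
  shows "integrable arc_measure (\<lambda>\<theta>. u \<theta> * k \<theta>)"
proof -
  have "compact (k ` {-pi..pi})" using k by (intro compact_continuous_image) auto
  then obtain B where B: "\<And>\<theta>. \<theta> \<in> {-pi..pi} \<Longrightarrow> norm (k \<theta>) \<le> B"
    unfolding image_iff Ball_def by (meson bounded_iff compact_imp_bounded imageI)
  have [measurable]: "k \<in> borel_measurable arc_measure"
    using k by (rule continuous_imp_measurable_on_sets_lebesgue) auto
  have [measurable]: "u \<in> borel_measurable arc_measure" using u by auto
  show ?thesis
  proof (rule Bochner_Integration.integrable_bound)
    show "integrable arc_measure (\<lambda>\<theta>. norm (u \<theta>) * B)" using u by simp
    show "AE \<theta> in arc_measure. norm (u \<theta> * k \<theta>) \<le> norm (norm (u \<theta>) * B)"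
    proof (rule AE_I2)
      fix \<theta> assume "\<theta> \<in> space arc_measure"
      hence \<theta>: "norm (k \<theta>) \<le> B" using B by simp
      hence "norm (u \<theta>) * norm (k \<theta>) \<le> norm (u \<theta>) * B" by (intro mult_left_mono) auto
      also have "\<dots> \<le> norm (norm (u \<theta>) * B)" by simp
      finally show "norm (u \<theta> * k \<theta>) \<le> norm (norm (u \<theta>) * B)" by (simp add: norm_mult)
    qed
  qed measurable
qed

lemma integrable_schwarz:
  assumes "integrable arc_measure u" "norm z < 1"
  shows "integrable arc_measure (\<lambda>\<theta>. complex_of_real (u \<theta>) * schwarz_kernel z \<theta>)"
  by (rule integrable_mult_continuous) (use assms in \<open>auto intro: schwarz_kernel_continuous\<close>)

lemma integrable_poisson:
  assumes "integrable arc_measure u" "norm z < 1"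
  shows "integrable arc_measure (\<lambda>\<theta>. u \<theta> * poisson_kernel z \<theta>)"
  using integrable_Re[OF integrable_schwarz[OF assms]] assms(2)
  by (simp add: Re_schwarz_kernel)

lemma Re_herglotz:
  assumes "integrable arc_measure u" "norm z < 1"
  shows "Re (herglotz u z) = 1 / (4 * pi) * (LINT \<theta>|arc_measure. u \<theta> * poisson_kernel z \<theta>)"
  using integral_Re[OF integrable_schwarz[OF assms]] assms(2)
  by (simp add: Re_schwarz_kernel herglotz_def)

lemma herglotz_add:
  assumes "integrable arc_measure u" "integrable arc_measure v" "norm z < 1"
  shows "herglotz (\<lambda>\<theta>. u \<theta> + v \<theta>) z = herglotz u z + herglotz v z"
  using integrable_schwarz assms by (simp add: herglotz_def ring_distribs)

lemma herglotz_diff: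
  assumes "integrable arc_measure u" "integrable arc_measure v" "norm z < 1"
  shows "herglotz (\<lambda>\<theta>. u \<theta> - v \<theta>) z = herglotz u z - herglotz v z"
  using integrable_schwarz assms by (simp add: herglotz_def ring_distribs)

lemma norm_herglotz_le:
  assumes u: "integrable arc_measure u" and "norm z \<le> r" "r < 1"
  shows "norm (herglotz u z) \<le> (LINT \<theta>|arc_measure. \<bar>u \<theta>\<bar>) / (2 * pi * (1 - r))"
proof -
  have "norm (LINT \<theta>|arc_measure. complex_of_real (u \<theta>) * schwarz_kernel z \<theta>)
        \<le> (LINT \<theta>|arc_measure. \<bar>u \<theta>\<bar> * (2 / (1 - r)))"
  proof (rule Bochner_Integration.integral_norm_bound_integral)
    show "integrable arc_measure (\<lambda>\<theta>. complex_of_real (u \<theta>) * schwarz_kernel z \<theta>)"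
      using assms by (intro integrable_schwarz) auto
    show "integrable arc_measure (\<lambda>\<theta>. \<bar>u \<theta>\<bar> * (2 / (1 - r)))"
      using u by (intro integrable_mult_left) auto
    show "norm (complex_of_real (u \<theta>) * schwarz_kernel z \<theta>) \<le> \<bar>u \<theta>\<bar> * (2 / (1 - r))" for \<theta>
      unfolding norm_mult using schwarz_kernel_bound[OF assms(2,3)] by (intro mult_mono) auto
  qed
  hence "norm (herglotz u z) \<le> 1 / (4 * pi) * (LINT \<theta>|arc_measure. \<bar>u \<theta>\<bar> * (2 / (1 - r)))"
    unfolding herglotz_def norm_mult norm_of_real by (intro mult_mono) auto
  also have "\<dots> = (LINT \<theta>|arc_measure. \<bar>u \<theta>\<bar>) / (2 * pi * (1 - r))"
    using \<open>r < 1\<close> by (simp add: divide_simps)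
  finally show ?thesis .
qed

text \<open>Makes room to apply the mean value property to functions with the factor \<open>1 - cnj z * s\<close> in a
  denominator or under a logarithm.\<close>
lemma zero_free_neighbourhood:
  assumes "\<rho> > (1::real)" "norm z < 1"
  obtains \<sigma> where "\<sigma> > 1" "\<sigma> \<le> \<rho>" "\<And>s. s \<in> ball 0 \<sigma> \<Longrightarrow> 1 - cnj z * s \<noteq> 0"
proof
  define \<sigma> where "\<sigma> = (if z = 0 then \<rho> else min \<rho> (1 / norm z))"
  show "\<sigma> > 1" "\<sigma> \<le> \<rho>" using assms by (auto simp: \<sigma>_def)
  show "1 - cnj z * s \<noteq> 0" if "s \<in> ball 0 \<sigma>" for s
  proof (cases "z = 0")
    case False
    hence "norm s < 1 / norm z" using that by (auto simp: \<sigma>_def)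
    hence "norm (cnj z * s) < 1" using False by (simp add: norm_mult field_simps)
    thus ?thesis by auto
  qed auto
qed

text \<open>Split \<open>Re G\<close> into \<open>G\<close> and its conjugate. The Schwarz kernel is \<open>2 s / (s - z) - 1\<close> at \<open>s = cis \<theta>\<close>, so
  the first part is an instance of Cauchy's formula. The conjugate of the second part is the mean
  value of a holomorphic function, so only its value at the origin remains.\<close>
lemma schwarz_formula:
  assumes hol: "G holomorphic_on ball 0 \<rho>" and "\<rho> > 1" and z: "norm z < 1"
  shows "herglotz (\<lambda>\<theta>. Re (G (cis \<theta>))) z = (G z - \<i> * Im (G 0)) / 2"
proof -
  have cG: "continuous_on (sphere 0 1) G"
    using \<open>\<rho> > 1\<close> by (intro holomorphic_on_imp_continuous_on holomorphic_on_subset[OF hol]) auto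
  have ker: "schwarz_kernel z \<theta> = 2 * (cis \<theta> / (cis \<theta> - z)) - 1" for \<theta>
  proof -
    have "cis \<theta> - z \<noteq> 0" using z by auto
    moreover have "1 - z * cis (-\<theta>) \<noteq> 0" using one_minus_mult_nz[OF z] by simp
    moreover have "cis (-\<theta>) * cis \<theta> = 1" by (simp add: cis_mult)
    ultimately show ?thesis unfolding schwarz_kernel_def
      by (simp add: divide_simps) (auto simp: algebra_simps)
  qed
  have I1: "integrable arc_measure (\<lambda>\<theta>. G (cis \<theta>))" using cG by (rule integrable_arc_circle)
  have "continuous_on (sphere 0 1) (\<lambda>s. G s * (s / (s - z)))"
    using z cG by (auto intro!: continuous_intros)
  from integrable_arc_circle[OF this] 
  have I2: "integrable arc_measure (\<lambda>\<theta>. G (cis \<theta>) * (cis \<theta> / (cis \<theta> - z)))" .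
  have 1: "(LINT \<theta>|arc_measure. G (cis \<theta>) * schwarz_kernel z \<theta>) = 2 * of_real pi * (2 * G z - G 0)"
  proof -
    have "(LINT \<theta>|arc_measure. G (cis \<theta>) * schwarz_kernel z \<theta>) =
          (LINT \<theta>|arc_measure. 2 * (G (cis \<theta>) * (cis \<theta> / (cis \<theta> - z))) - G (cis \<theta>))"
      by (simp add: ker algebra_simps)
    also have "\<dots> = 2 * (LINT \<theta>|arc_measure. G (cis \<theta>) * (cis \<theta> / (cis \<theta> - z))) - (LINT \<theta>|arc_measure. G (cis \<theta>))"
      using I1 I2 by (subst Bochner_Integration.integral_diff)
        (auto simp del: times_divide_eq_right intro!: integrable_mult_right)
    also have "\<dots> = 2 * (2 * of_real pi * G z) - 2 * of_real pi * G 0"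
      unfolding circle_Cauchy_integral[OF hol \<open>\<rho> > 1\<close> z] circle_mean_value[OF hol \<open>\<rho> > 1\<close>] ..
    finally show ?thesis by (simp add: algebra_simps)
  qed
  have 2: "(LINT \<theta>|arc_measure. cnj (G (cis \<theta>)) * schwarz_kernel z \<theta>) = 2 * of_real pi * cnj (G 0)"
  proof -
    obtain \<sigma> where \<sigma>: "\<sigma> > 1" "\<sigma> \<le> \<rho>" and nz: "\<And>s. s \<in> ball 0 \<sigma> \<Longrightarrow> 1 - cnj z * s \<noteq> 0"
      using zero_free_neighbourhood[OF \<open>\<rho> > 1\<close> z] by blast
    define F where "F = (\<lambda>s. G s * ((1 + cnj z * s) / (1 - cnj z * s)))"
    have "F holomorphic_on ball 0 \<sigma>"
      unfolding F_def using nz \<sigma>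
      by (auto intro!: holomorphic_intros holomorphic_on_subset[OF hol])
    from circle_mean_value[OF this \<sigma>(1)] have F: "(LINT \<theta>|arc_measure. F (cis \<theta>)) = 2 * of_real pi * G 0"
      by (simp add: F_def)
    have "cnj (F (cis \<theta>)) = cnj (G (cis \<theta>)) * schwarz_kernel z \<theta>" for \<theta>
      by (simp add: F_def schwarz_kernel_def cis_cnj)
    hence "(LINT \<theta>|arc_measure. cnj (G (cis \<theta>)) * schwarz_kernel z \<theta>) = (LINT \<theta>|arc_measure. cnj (F (cis \<theta>)))"
      by simp
    also have "\<dots> = cnj (LINT \<theta>|arc_measure. F (cis \<theta>))" by simp
    finally show ?thesis using F by simp
  qed
  have I3: "integrable arc_measure (\<lambda>\<theta>. G (cis \<theta>) * schwarz_kernel z \<theta>)"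
    by (rule integrable_mult_continuous[OF I1 schwarz_kernel_continuous[OF z]])
  have I4: "integrable arc_measure (\<lambda>\<theta>. cnj (G (cis \<theta>)) * schwarz_kernel z \<theta>)"
    using I1 by (intro integrable_mult_continuous schwarz_kernel_continuous[OF z]) auto
  have "(LINT \<theta>|arc_measure. complex_of_real (Re (G (cis \<theta>))) * schwarz_kernel z \<theta>) =
        (LINT \<theta>|arc_measure. (G (cis \<theta>) * schwarz_kernel z \<theta> + cnj (G (cis \<theta>)) * schwarz_kernel z \<theta>) / 2)"
    by (intro Bochner_Integration.integral_cong refl) (simp add: complex_add_cnj flip: ring_distribs)
  also have "\<dots> = (2 * of_real pi * (2 * G z - G 0) + 2 * of_real pi * cnj (G 0)) / 2"
    using I3 I4 1 2 by simp
  also have "\<dots> = 2 * of_real pi * (G z - \<i> * Im (G 0))"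
  proof -
    have "cnj (G 0) = G 0 - 2 * \<i> * Im (G 0)" by (simp add: complex_eq_iff)
    show ?thesis by (subst \<open>cnj (G 0) = _\<close>) (simp add: field_simps)
  qed
  finally show ?thesis by (simp add: herglotz_def)
qed

lemma integral_poisson_kernel:
  assumes "norm z < 1"
  shows "(LINT \<theta>|arc_measure. poisson_kernel z \<theta>) = 2 * pi"
proof -
  have "Re (herglotz (\<lambda>\<theta>. 1) z) = 1 / 2"
    using arg_cong[OF schwarz_formula[of "\<lambda>_. 1" 2 z], of Re] assms by simp
  moreover have "Re (herglotz (\<lambda>_. 1) z) = (LINT \<theta>|arc_measure. poisson_kernel z \<theta>) / (4 * pi)"
    using Re_herglotz[of "\<lambda>_. 1" z] assms by simp
  ultimately have "(LINT \<theta>|arc_measure. poisson_kernel z \<theta>) / (4 * pi) = 1 / 2" by metis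
  hence "(LINT \<theta>|arc_measure. poisson_kernel z \<theta>) = (1 / 2) * (4 * pi)"
    by (subst (asm) divide_eq_eq) auto
  thus ?thesis by simp
qed

section \<open>The upper bound from Jensen's inequality\<close>

text \<open>A zero \<open>a\<close> inside the disc is moved to its mirror image \<open>1 / cnj a\<close>: the factor \<open>z - a\<close> becomes
  \<open>1 - cnj a * z\<close>, whose modulus is the same on the circle and larger inside.\<close>

lemma poly_circle_reflect:
  fixes p :: "complex poly"
  assumes "p \<noteq> 0"
  shows "\<exists>q. (\<forall>s. cmod s = 1 \<longrightarrow> cmod (poly q s) = cmod (poly p s)) \<and>
             (\<forall>z. cmod z \<le> 1 \<longrightarrow> cmod (poly p z) \<le> cmod (poly q z)) \<and>
             (\<forall>z. cmod z < 1 \<longrightarrow> poly q z \<noteq> 0)"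
  using assms
proof (induction "degree p" arbitrary: p)
  case 0
  then obtain c where "p = [:c:]" by (metis degree_eq_zeroE)
  thus ?case using 0 by (intro exI[of _ p]) auto
next
  case (Suc n)
  have "\<not> constant (poly p)" using Suc by (metis constant_degree nat.distinct(1))
  then obtain a where "poly p a = 0" using fundamental_theorem_of_algebra by blast
  then obtain p' where p: "p = [:-a, 1:] * p'" by (metis poly_eq_0_iff_dvd dvdE)
  have "p' \<noteq> 0" using Suc p by auto
  moreover have "n = degree p'" using Suc(2) \<open>p' \<noteq> 0\<close> unfolding p by (subst (asm) degree_mult_eq) auto
  ultimately obtain q' where q': "\<And>s. cmod s = 1 \<Longrightarrow> cmod (poly q' s) = cmod (poly p' s)"
    "\<And>z. cmod z \<le> 1 \<Longrightarrow> cmod (poly p' z) \<le> cmod (poly q' z)" "\<And>z. cmod z < 1 \<Longrightarrow> poly q' z \<noteq> 0"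
    using Suc(1)[of p'] by blast
  define l where "l = (if cmod a < 1 then [:1, - cnj a:] else [:-a, 1:])"
  have key: "(cmod (1 - cnj a * z))\<^sup>2 - (cmod (z - a))\<^sup>2 = (1 - (cmod z)\<^sup>2) * (1 - (cmod a)\<^sup>2)" for z
    unfolding cmod_power2 by (simp add: algebra_simps power2_eq_square)
  have l1: "cmod (poly l s) = cmod (poly [:-a, 1:] s)" if "cmod s = 1" for s
  proof -
    have "(cmod (1 - cnj a * s))\<^sup>2 = (cmod (s - a))\<^sup>2" using key[of s] that by simp
    hence "cmod (1 - cnj a * s) = cmod (s - a)" by (simp add: power2_eq_iff_nonneg)
    thus ?thesis by (simp add: l_def algebra_simps)
  qed
  have l2: "cmod (poly [:-a, 1:] z) \<le> cmod (poly l z)" if "cmod z \<le> 1" for z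
  proof (cases "cmod a < 1")
    case True
    have "(1 - (cmod z)\<^sup>2) * (1 - (cmod a)\<^sup>2) \<ge> 0" using that True
      by (intro mult_nonneg_nonneg) (auto simp: abs_square_le_1)
    hence "(cmod (z - a))\<^sup>2 \<le> (cmod (1 - cnj a * z))\<^sup>2" using key[of z] by linarith
    hence "cmod (z - a) \<le> cmod (1 - cnj a * z)" by (rule power2_le_imp_le) simp
    thus ?thesis using True by (simp add: l_def algebra_simps)
  qed (simp add: l_def)
  have l3: "poly l z \<noteq> 0" if "cmod z < 1" for z
  proof (cases "cmod a < 1")
    case True
    thus ?thesis using one_minus_mult_nz[of "cnj a" z] that by (simp add: l_def algebra_simps)
  next
    case False
    thus ?thesis using that by (auto simp: l_def)
  qed
  show ?case
  proof (intro exI[of _ "l * q'"] conjI allI impI)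
    show "cmod (poly (l * q') s) = cmod (poly p s)" if "cmod s = 1" for s
      unfolding p poly_mult norm_mult l1[OF that] q'(1)[OF that] ..
    show "cmod (poly p z) \<le> cmod (poly (l * q') z)" if "cmod z \<le> 1" for z
      unfolding p poly_mult norm_mult using l2[OF that] q'(2)[OF that] by (intro mult_mono) auto
    show "poly (l * q') z \<noteq> 0" if "cmod z < 1" for z
      using l3[OF that] q'(3)[OF that] by simp
  qed
qed

locale szego_weight =
  fixes \<mu> :: "complex measure" and W :: "real \<Rightarrow> real"
  assumes circle: "borel_prob_on_circle \<mu>" and szego: "szego_class \<mu> W"
begin

abbreviation D :: "complex \<Rightarrow> complex" where "D \<equiv> szego_function W"

lemma W_measurable [measurable]: "W \<in> borel_measurable arc_measure"
  and W_nonneg: "\<And>\<theta>. \<theta> \<in> {-pi..pi} \<Longrightarrow> W \<theta> \<ge> 0"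
  and W_integrable: "integrable arc_measure W"
  and W_pos: "AE \<theta> in arc_measure. W \<theta> > 0"
  and \<mu>_eq: "\<mu> = distr (density arc_measure (\<lambda>\<theta>. ennreal (W \<theta> / (2 * pi))))
              (restrict_space borel (sphere 0 1)) cis"
  using szego unfolding szego_class_def by auto

lemma lnW_integrable: "integrable arc_measure (\<lambda>\<theta>. ln (W \<theta>))"
proof (rule Bochner_Integration.integrable_bound)
  show "integrable arc_measure (\<lambda>\<theta>. \<bar>ln (W \<theta>)\<bar>)" using szego unfolding szego_class_def by auto
qed auto

lemma prob_space_\<mu>: "prob_space \<mu>"
  and sets_\<mu>: "sets \<mu> = sets (restrict_space borel (sphere 0 1))"
  using circle unfolding borel_prob_on_circle_def by auto

lemma space_\<mu>: "space \<mu> = sphere 0 1"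
  using sets_eq_imp_space_eq[OF sets_\<mu>] by (simp add: space_restrict_space)

lemma continuous_measurable_\<mu>:
  fixes f :: "complex \<Rightarrow> 'a::euclidean_space"
  assumes "continuous_on (sphere 0 1) f"
  shows "f \<in> borel_measurable \<mu>"
  using borel_measurable_continuous_on_restrict[OF assms] measurable_cong_sets[OF sets_\<mu> refl] by blast

lemma continuous_integrable_\<mu>:
  fixes f :: "complex \<Rightarrow> 'a::euclidean_space"
  assumes f: "continuous_on (sphere 0 1) f"
  shows "integrable \<mu> f"
proof -
  interpret prob_space \<mu> by (rule prob_space_\<mu>)
  have "compact (f ` sphere 0 1)" using f by (intro compact_continuous_image) auto
  then obtain B where "\<forall>x\<in>sphere 0 1. norm (f x) \<le> B"
    by (meson bounded_iff compact_imp_bounded imageI)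
  thus ?thesis using continuous_measurable_\<mu>[OF f]
    by (intro integrable_const_bound[where B = B]) (auto simp: space_\<mu> intro!: AE_I2)
qed

lemma integral_\<mu>:
  fixes f :: "complex \<Rightarrow> real"
  assumes f: "continuous_on (sphere 0 1) f"
  shows "(LINT x|\<mu>. f x) = (LINT \<theta>|arc_measure. W \<theta> * f (cis \<theta>)) / (2 * pi)"
    and "integrable arc_measure (\<lambda>\<theta>. W \<theta> * f (cis \<theta>))"
proof -
  let ?S = "restrict_space borel (sphere 0 1) :: complex measure"
  have cis: "cis \<in> measurable arc_measure ?S"
    by (intro measurable_restrict_space2 continuous_imp_measurable_on_sets_lebesgue)
       (auto intro!: continuous_intros)
  hence cis': "cis \<in> measurable (density arc_measure (\<lambda>\<theta>. ennreal (W \<theta> / (2 * pi)))) ?S" by simp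
  have fm: "f \<in> borel_measurable ?S" by (rule borel_measurable_continuous_on_restrict[OF f])
  have fcis: "(\<lambda>\<theta>. f (cis \<theta>)) \<in> borel_measurable arc_measure"
    by (rule measurable_compose[OF cis fm])
  have nn: "AE \<theta> in arc_measure. 0 \<le> W \<theta> / (2 * pi)" using W_nonneg by (auto intro!: AE_I2)
  have "(LINT x|\<mu>. f x) = (LINT \<theta>|arc_measure. (W \<theta> / (2 * pi)) *\<^sub>R f (cis \<theta>))"
    unfolding \<mu>_eq by (subst integral_distr[OF cis' fm], subst integral_density[OF fcis _ nn]) auto
  thus "(LINT x|\<mu>. f x) = (LINT \<theta>|arc_measure. W \<theta> * f (cis \<theta>)) / (2 * pi)" by simp
  show "integrable arc_measure (\<lambda>\<theta>. W \<theta> * f (cis \<theta>))"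
    using W_integrable
    by (intro integrable_mult_continuous continuous_on_compose2[OF f]) (auto intro!: continuous_intros)
qed

text \<open>Jensen's inequality, applied as \<open>exp m * (1 + (u - m)) \<le> exp u\<close> with \<open>m\<close> the Poisson mean of \<open>u\<close>.
  The extra factor \<open>1 - cnj z * s\<close> in \<open>F\<close> absorbs the Poisson kernel, since \<open>|q|\<^sup>2\<close> is
  \<open>|F|\<^sup>2 P / (1 - |z|\<^sup>2)\<close> on the circle with \<open>P\<close> the Poisson kernel at \<open>z\<close>. As \<open>F\<close> is zero-free it has
  a holomorphic logarithm, for which the Poisson integral is evaluation.\<close>
lemma zero_free_bound:
  assumes hol: "q holomorphic_on ball 0 \<rho>" and "\<rho> > 1"
    and nz: "\<And>s. s \<in> ball 0 \<rho> \<Longrightarrow> q s \<noteq> 0" and z: "cmod z < 1"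
  shows "(1 - (cmod z)\<^sup>2) * (cmod (q z * D z))\<^sup>2 \<le> (LINT x|\<mu>. (cmod (q x))\<^sup>2)"
proof -
  obtain \<sigma> where \<sigma>: "\<sigma> > 1" "\<sigma> \<le> \<rho>" and nz': "\<And>s. s \<in> ball 0 \<sigma> \<Longrightarrow> 1 - cnj z * s \<noteq> 0"
    using zero_free_neighbourhood[OF \<open>\<rho> > 1\<close> z] by blast
  define F where "F = (\<lambda>s. q s * (1 - cnj z * s))"
  have holF: "F holomorphic_on ball 0 \<sigma>"
    unfolding F_def using \<sigma> by (auto intro!: holomorphic_intros holomorphic_on_subset[OF hol])
  have Fnz: "F s \<noteq> 0" if "s \<in> ball 0 \<sigma>" for s using nz nz' \<sigma> that by (auto simp: F_def)
  obtain G where holG: "G holomorphic_on ball 0 \<sigma>" and FG: "\<And>s. s \<in> ball 0 \<sigma> \<Longrightarrow> F s = exp (G s)"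
    using contractible_imp_holomorphic_log[OF holF convex_imp_contractible[OF convex_ball] Fnz] by blast
  define u where "u = (\<lambda>\<theta>. Re (2 * G (cis \<theta>)) + ln (W \<theta>))"
  have contG: "continuous_on (sphere 0 1) G"
    using \<sigma> by (intro holomorphic_on_imp_continuous_on holomorphic_on_subset[OF holG]) auto
  have contq: "continuous_on (sphere 0 1) q"
    using \<open>\<rho> > 1\<close> by (intro holomorphic_on_imp_continuous_on holomorphic_on_subset[OF hol]) auto
  have uG: "integrable arc_measure (\<lambda>\<theta>. Re (2 * G (cis \<theta>)))"
    using contG by (intro integrable_arc_circle) (auto intro!: continuous_intros)
  have u: "integrable arc_measure u" unfolding u_def using uG lnW_integrable by auto
  define m where "m = (LINT \<theta>|arc_measure. u \<theta> * poisson_kernel z \<theta>) / (2 * pi)"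
  have z1: "1 - (cmod z)\<^sup>2 > 0" using z by (simp add: abs_square_less_1)
  have em: "exp m = (cmod (F z * D z))\<^sup>2"
  proof -
    have "m = 2 * Re (herglotz u z)" unfolding m_def Re_herglotz[OF u z] by simp
    also have "herglotz u z = (2 * G z - \<i> * Im (2 * G 0)) / 2 + herglotz (\<lambda>\<theta>. ln (W \<theta>)) z"
      unfolding u_def herglotz_add[OF uG lnW_integrable z]
      by (subst schwarz_formula[of "\<lambda>s. 2 * G s" \<sigma>]) (use holG \<sigma> z in \<open>auto intro!: holomorphic_intros\<close>)
    finally have "m = 2 * (Re (G z) + Re (herglotz (\<lambda>\<theta>. ln (W \<theta>)) z))" by simp
    hence "exp m = (exp (Re (G z)) * exp (Re (herglotz (\<lambda>\<theta>. ln (W \<theta>)) z)))\<^sup>2"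
      by (simp add: exp_double exp_add power_mult_distrib)
    also have "\<dots> = (cmod (exp (G z) * exp (herglotz (\<lambda>\<theta>. ln (W \<theta>)) z)))\<^sup>2"
      by (simp add: norm_mult)
    finally show ?thesis using FG[of z] z \<sigma> by (simp add: szego_function_eq)
  qed
  have pt: "exp m / (1 - (cmod z)\<^sup>2) * ((1 - m) * poisson_kernel z \<theta> + u \<theta> * poisson_kernel z \<theta>)
              \<le> W \<theta> * (cmod (q (cis \<theta>)))\<^sup>2" if "W \<theta> > 0" for \<theta>
  proof -
    have cb: "cis \<theta> \<in> ball 0 \<sigma>" using \<sigma> by auto
    have "exp (u \<theta>) = (cmod (exp (G (cis \<theta>))))\<^sup>2 * W \<theta>"
      using that by (simp add: u_def exp_add exp_double)
    also have "\<dots> = (cmod (q (cis \<theta>)))\<^sup>2 * (cmod (1 - cnj z * cis \<theta>))\<^sup>2 * W \<theta>"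
      using FG[OF cb] by (simp add: F_def norm_mult power_mult_distrib flip: FG[OF cb])
    finally have eu: "exp (u \<theta>) * poisson_kernel z \<theta> = (1 - (cmod z)\<^sup>2) * (W \<theta> * (cmod (q (cis \<theta>)))\<^sup>2)"
      using nz'[OF cb] by (simp add: poisson_kernel_def)
    have "exp m * (1 + (u \<theta> - m)) \<le> exp m * exp (u \<theta> - m)"
      by (intro mult_left_mono exp_ge_add_one_self) auto
    also have "\<dots> = exp (u \<theta>)" by (simp flip: exp_add)
    finally have "exp m * (1 + (u \<theta> - m)) * poisson_kernel z \<theta> \<le> exp (u \<theta>) * poisson_kernel z \<theta>"
      using poisson_kernel_pos[OF z, of \<theta>] by (intro mult_right_mono) auto
    thus ?thesis unfolding eu using z1 by (simp add: field_simps)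
  qed
  have ip: "integrable arc_measure (poisson_kernel z)" using integrable_poisson[of "\<lambda>_. 1" z] z by simp
  have iu: "integrable arc_measure (\<lambda>\<theta>. u \<theta> * poisson_kernel z \<theta>)" by (rule integrable_poisson[OF u z])
  have cq: "continuous_on (sphere 0 1) (\<lambda>s. (cmod (q s))\<^sup>2)" using contq by (intro continuous_intros)
  have "(LINT \<theta>|arc_measure. exp m / (1 - (cmod z)\<^sup>2) * ((1 - m) * poisson_kernel z \<theta> + u \<theta> * poisson_kernel z \<theta>))
        \<le> (LINT \<theta>|arc_measure. W \<theta> * (cmod (q (cis \<theta>)))\<^sup>2)"
    using W_pos pt ip iu integral_\<mu>(2)[OF cq]
    by (intro integral_mono_AE) (auto elim!: eventually_mono)
  also have "(LINT \<theta>|arc_measure. exp m / (1 - (cmod z)\<^sup>2) * ((1 - m) * poisson_kernel z \<theta> + u \<theta> * poisson_kernel z \<theta>))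
     = exp m / (1 - (cmod z)\<^sup>2) * ((1 - m) * (2 * pi) + m * (2 * pi))"
    using ip iu by (simp add: integral_poisson_kernel[OF z] m_def)
  also have "\<dots> = exp m / (1 - (cmod z)\<^sup>2) * (2 * pi)" by (simp add: algebra_simps)
  finally have "exp m / (1 - (cmod z)\<^sup>2) \<le> (LINT x|\<mu>. (cmod (q x))\<^sup>2)"
    by (simp add: integral_\<mu>(1)[OF cq] field_simps)
  moreover have "exp m / (1 - (cmod z)\<^sup>2) = (1 - (cmod z)\<^sup>2) * (cmod (q z * D z))\<^sup>2"
  proof -
    have "cmod (1 - cnj z * z) = 1 - (cmod z)\<^sup>2"
    proof -
      have "1 - cnj z * z = complex_of_real (1 - (cmod z)\<^sup>2)"
        using complex_norm_square[of z] by (simp add: mult.commute)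
      thus ?thesis using z1 by (metis abs_of_pos norm_of_real)
    qed
    thus ?thesis unfolding em F_def using z1
      by (simp add: norm_mult power_mult_distrib power2_eq_square)
  qed
  ultimately show ?thesis by simp
qed

text \<open>The reflected polynomial may still vanish on the circle. Its dilations \<open>x \<mapsto> q (t * x)\<close> with
  \<open>t < 1\<close> are zero-free on a larger disc, and \<open>t\<close> tends to 1 on both sides of the bound.\<close>
lemma polynomial_bound:
  assumes z: "cmod z < 1"
  shows "(1 - (cmod z)\<^sup>2) * (cmod (poly p z * D z))\<^sup>2 \<le> (LINT x|\<mu>. (cmod (poly p x))\<^sup>2)"
proof (cases "p = 0")
  case False
  then obtain q where q: "\<And>s. cmod s = 1 \<Longrightarrow> cmod (poly q s) = cmod (poly p s)"
    "\<And>z. cmod z \<le> 1 \<Longrightarrow> cmod (poly p z) \<le> cmod (poly q z)" "\<And>z. cmod z < 1 \<Longrightarrow> poly q z \<noteq> 0"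
    using poly_circle_reflect by blast
  define t where "t = (\<lambda>n::nat. 1 - 1 / (real n + 2))"
  have t01: "0 < t n" "t n < 1" for n by (auto simp: t_def field_simps)
  have t: "t \<longlonglongrightarrow> 1" unfolding t_def by real_asymp
  have bound: "(1 - (cmod z)\<^sup>2) * (cmod (poly q (of_real (t n) * z) * D z))\<^sup>2
      \<le> (LINT x|\<mu>. (cmod (poly q (of_real (t n) * x)))\<^sup>2)" for n
  proof (rule zero_free_bound[where \<rho> = "1 / t n"])
    show "(\<lambda>a. poly q (complex_of_real (t n) * a)) holomorphic_on ball 0 (1 / t n)"
      by (intro holomorphic_intros)
    show "1 < 1 / t n" using t01[of n] by simp
    show "poly q (complex_of_real (t n) * s) \<noteq> 0" if "s \<in> ball 0 (1 / t n)" for s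
      using that t01[of n] by (intro q(3)) (simp add: norm_mult field_simps)
  qed (use z in auto)
  have t': "(\<lambda>n. complex_of_real (t n)) \<longlonglongrightarrow> 1" using tendsto_of_real[OF t] by simp
  have "(\<lambda>n. (1 - (cmod z)\<^sup>2) * (cmod (poly q (of_real (t n) * z) * D z))\<^sup>2)
        \<longlonglongrightarrow> (1 - (cmod z)\<^sup>2) * (cmod (poly q (1 * z) * D z))\<^sup>2"
    by (intro tendsto_intros t')
  moreover have "(\<lambda>n. LINT x|\<mu>. (cmod (poly q (of_real (t n) * x)))\<^sup>2) \<longlonglongrightarrow> (LINT x|\<mu>. (cmod (poly q x))\<^sup>2)"
  proof -
    interpret prob_space \<mu> by (rule prob_space_\<mu>)
    have "bounded (poly q ` cball 0 1)"
      by (intro compact_imp_bounded compact_continuous_image continuous_intros) auto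
    then obtain B where B: "\<And>x. cmod x \<le> 1 \<Longrightarrow> cmod (poly q x) \<le> B"
      unfolding bounded_iff by (metis imageI mem_cball_0)
    show ?thesis
    proof (rule integral_dominated_convergence[where w = "\<lambda>_. B\<^sup>2"])
      show "(\<lambda>x. (cmod (poly q x))\<^sup>2) \<in> borel_measurable \<mu>"
        by (intro continuous_measurable_\<mu> continuous_intros)
      show "(\<lambda>x. (cmod (poly q (of_real (t n) * x)))\<^sup>2) \<in> borel_measurable \<mu>" for n
        by (intro continuous_measurable_\<mu> continuous_intros)
      show "AE x in \<mu>. (\<lambda>n. (cmod (poly q (of_real (t n) * x)))\<^sup>2) \<longlonglongrightarrow> (cmod (poly q x))\<^sup>2"
      proof (rule AE_I2)
        fix x
        have "(\<lambda>n. (cmod (poly q (of_real (t n) * x)))\<^sup>2) \<longlonglongrightarrow> (cmod (poly q (1 * x)))\<^sup>2"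
          by (intro tendsto_intros t')
        thus "(\<lambda>n. (cmod (poly q (of_real (t n) * x)))\<^sup>2) \<longlonglongrightarrow> (cmod (poly q x))\<^sup>2" by simp
      qed
      show "AE x in \<mu>. norm ((cmod (poly q (of_real (t n) * x)))\<^sup>2) \<le> B\<^sup>2" for n
      proof (rule AE_I2)
        fix x assume "x \<in> space \<mu>"
        hence "cmod (of_real (t n) * x) \<le> 1" using t01[of n] by (simp add: norm_mult space_\<mu>)
        thus "norm ((cmod (poly q (of_real (t n) * x)))\<^sup>2) \<le> B\<^sup>2"
          using B by (auto intro!: power_mono)
      qed
    qed auto
  qed
  ultimately have "(1 - (cmod z)\<^sup>2) * (cmod (poly q (1 * z) * D z))\<^sup>2 \<le> (LINT x|\<mu>. (cmod (poly q x))\<^sup>2)"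
    using bound by (intro LIMSEQ_le) auto
  also have "(LINT x|\<mu>. (cmod (poly q x))\<^sup>2) = (LINT x|\<mu>. (cmod (poly p x))\<^sup>2)"
    using q(1) by (intro Bochner_Integration.integral_cong) (auto simp: space_\<mu>)
  finally have "(1 - (cmod z)\<^sup>2) * (cmod (poly q z * D z))\<^sup>2 \<le> (LINT x|\<mu>. (cmod (poly p x))\<^sup>2)" by simp
  moreover have "(1 - (cmod z)\<^sup>2) * (cmod (poly p z * D z))\<^sup>2 \<le> (1 - (cmod z)\<^sup>2) * (cmod (poly q z * D z))\<^sup>2"
    using q(2)[of z] z by (intro mult_left_mono power_mono) (auto simp: norm_mult abs_square_le_1 intro!: mult_right_mono)
  ultimately show ?thesis by linarith
qed auto

end

section \<open>Approximation of the logarithm of the weight\<close>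

text \<open>Real parts of polynomials, restricted to the circle, are the real trigonometric polynomials. That
  they are closed under multiplication reduces to this lemma, which eliminates the conjugate by
  using that \<open>s * cnj s\<close> is 1.\<close>

lemma Re_mult_cnj_circle_poly:
  fixes p q :: "complex poly"
  shows "\<exists>f. \<forall>s. cmod s = 1 \<longrightarrow> Re (poly p s * cnj (poly q s)) = Re (poly f s)"
proof (induction q arbitrary: p)
  case 0
  show ?case by (intro exI[of _ 0]) auto
next
  case (pCons a q)
  obtain b p' where p: "p = pCons b p'" by (cases p)
  obtain f where f: "\<And>s. cmod s = 1 \<Longrightarrow> Re (poly p' s * cnj (poly q s)) = Re (poly f s)"
    using pCons by blast
  show ?case
  proof (intro exI[of _ "smult (cnj a) p + smult (cnj b) (pCons 0 q) + f"] allI impI)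
    fix s :: complex assume s: "cmod s = 1"
    have ss: "s * cnj s = 1" using complex_norm_square[of s] s by simp
    have "poly p s * cnj (poly (pCons a q) s) =
            cnj a * poly p s + b * cnj (s * poly q s) + (s * cnj s) * (poly p' s * cnj (poly q s))"
      by (simp add: p algebra_simps)
    also have "\<dots> = cnj a * poly p s + b * cnj (s * poly q s) + poly p' s * cnj (poly q s)"
      by (simp add: ss)
    finally have "Re (poly p s * cnj (poly (pCons a q) s)) =
        Re (cnj a * poly p s) + Re (b * cnj (s * poly q s)) + Re (poly f s)"
      using f[OF s] by simp
    also have "Re (b * cnj (s * poly q s)) = Re (cnj b * (s * poly q s))"
      by (simp add: algebra_simps)
    finally show "Re (poly p s * cnj (poly (pCons a q) s)) =
        Re (poly (smult (cnj a) p + smult (cnj b) (pCons 0 q) + f) s)"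
      by (simp add: algebra_simps)
  qed
qed

lemma real_polynomial_function_circle:
  fixes g :: "complex \<Rightarrow> real"
  assumes "real_polynomial_function g"
  shows "\<exists>q. \<forall>s. cmod s = 1 \<longrightarrow> g s = Re (poly q s)"
  using assms
proof induction
  case (linear f)
  interpret bounded_linear f by fact
  have "f s = Re (poly [:0, complex_of_real (f 1) - \<i> * complex_of_real (f \<i>):] s)" for s
  proof -
    have "s = Re s *\<^sub>R 1 + Im s *\<^sub>R \<i>" by (simp add: complex_eq_iff)
    hence "f s = f (Re s *\<^sub>R 1 + Im s *\<^sub>R \<i>)" by simp
    also have "\<dots> = Re s * f 1 + Im s * f \<i>" by (simp only: add scaleR real_scaleR_def)
    finally show ?thesis by simp
  qed
  thus ?case by blast
next
  case (const c)
  show ?case by (intro exI[of _ "[:complex_of_real c:]"]) auto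
next
  case (add f g)
  then obtain p q where "\<And>s. cmod s = 1 \<Longrightarrow> f s = Re (poly p s)" "\<And>s. cmod s = 1 \<Longrightarrow> g s = Re (poly q s)"
    by metis
  thus ?case by (intro exI[of _ "p + q"]) auto
next
  case (mult f g)
  then obtain p q where pq: "\<And>s. cmod s = 1 \<Longrightarrow> f s = Re (poly p s)" "\<And>s. cmod s = 1 \<Longrightarrow> g s = Re (poly q s)"
    by metis
  obtain h where h: "\<And>s. cmod s = 1 \<Longrightarrow> Re (poly p s * cnj (poly q s)) = Re (poly h s)"
    using Re_mult_cnj_circle_poly by metis
  show ?case
  proof (intro exI[of _ "smult (1/2) (p * q + h)"] allI impI)
    fix s :: complex assume s: "cmod s = 1"
    have "Re (poly (smult (1/2) (p * q + h)) s) = (Re (poly p s * poly q s) + Re (poly h s)) / 2"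
      by simp
    also have "\<dots> = f s * g s" unfolding h[OF s, symmetric] pq[OF s] by simp
    finally show "f s * g s = Re (poly (smult (1/2) (p * q + h)) s)" ..
  qed
qed

lemma continuous_circle_approx:
  fixes f :: "complex \<Rightarrow> real"
  assumes "continuous_on (sphere 0 1) f" "e > 0"
  shows "\<exists>q. \<forall>s. cmod s = 1 \<longrightarrow> \<bar>f s - Re (poly q s)\<bar> < e"
proof -
  obtain g where "real_polynomial_function g" "\<And>x. x \<in> sphere 0 1 \<Longrightarrow> \<bar>f x - g x\<bar> < e"
    using Stone_Weierstrass_real_polynomial_function[OF _ assms] by auto
  thus ?thesis using real_polynomial_function_circle[of g] by (metis mem_sphere_0)
qed

text \<open>The first factor vanishes at \<open>-1\<close>, where \<^const>\<open>Arg\<close> jumps, and so glues the two ends of the interval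
  together.\<close>
lemma continuous_on_circle_pullback:
  fixes g :: "real \<Rightarrow> real"
  assumes g: "continuous_on UNIV g" and bd: "\<And>\<theta>. \<bar>g \<theta>\<bar> \<le> L"
  shows "continuous_on (sphere 0 1) (\<lambda>s. min 1 (c * cmod (s + 1)) * g (Arg s))"
  unfolding continuous_on_eq_continuous_within
proof
  fix s :: complex assume s: "s \<in> sphere 0 1"
  have cmin: "continuous (at s within sphere 0 1) (\<lambda>s. min 1 (c * cmod (s + 1)))"
    by (intro continuous_intros)
  show "continuous (at s within sphere 0 1) (\<lambda>s. min 1 (c * cmod (s + 1)) * g (Arg s))"
  proof (cases "s = -1")
    case True
    have "((\<lambda>s. min 1 (c * cmod (s + 1)) * g (Arg s)) \<longlongrightarrow> 0) (at s within sphere 0 1)"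
    proof (rule Lim_null_comparison)
      show "\<forall>\<^sub>F x in at s within sphere 0 1. norm (min 1 (c * cmod (x + 1)) * g (Arg x)) \<le> \<bar>min 1 (c * cmod (x + 1))\<bar> * L"
        using bd by (auto simp: abs_mult intro!: always_eventually mult_left_mono)
      have "((\<lambda>x. \<bar>min 1 (c * cmod (x + 1))\<bar> * L) \<longlongrightarrow> \<bar>min 1 (c * cmod (s + 1))\<bar> * L) (at s within sphere 0 1)"
        by (intro tendsto_intros)
      thus "((\<lambda>x. \<bar>min 1 (c * cmod (x + 1))\<bar> * L) \<longlongrightarrow> 0) (at s within sphere 0 1)" by (simp add: True)
    qed
    thus ?thesis by (simp add: continuous_within True)
  next
    case False
    have "s \<notin> \<real>\<^sub>\<le>\<^sub>0"
    proof
      assume "s \<in> \<real>\<^sub>\<le>\<^sub>0"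
      then obtain x where "s = complex_of_real x" "x \<le> 0" by (elim nonpos_Reals_cases)
      with s False show False by auto
    qed
    hence "continuous (at s within sphere 0 1) Arg"
      by (intro continuous_within_Arg)
    moreover have "isCont g (Arg s)" using g by (simp add: continuous_on_eq_continuous_at)
    ultimately have "continuous (at s within sphere 0 1) (\<lambda>s. g (Arg s))"
      by (rule continuous_within_compose3[rotated])
    with cmin show ?thesis by (intro continuous_intros)
  qed
qed

text \<open>A Lebesgue measurable function is an almost everywhere limit of continuous functions. These are
  truncated at height \<open>L\<close>, cut off near the point \<open>-1\<close> of the circle on a shrinking arc, and then
  replaced by trigonometric polynomials with the theorem of Stone and Weierstrass. The uniform bound
  is what dominated convergence needs later.\<close>
lemma bounded_measurable_circle_approx:
  fixes u :: "real \<Rightarrow> real"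
  assumes u: "u \<in> borel_measurable arc_measure" and bd: "\<And>\<theta>. \<bar>u \<theta>\<bar> \<le> L"
  shows "\<exists>Q. (\<forall>n s. cmod s = 1 \<longrightarrow> \<bar>Re (poly (Q n) s)\<bar> \<le> L + 1) \<and>
             (AE \<theta> in arc_measure. (\<lambda>n. Re (poly (Q n) (cis \<theta>))) \<longlonglongrightarrow> u \<theta>)"
proof -
  have "u measurable_on {-pi..pi}" using u by (simp add: measurable_on_iff_borel_measurable)
  then obtain N g where N: "negligible N" and g: "\<And>n. continuous_on UNIV (g n)"
    and lim: "\<And>x. x \<notin> N \<Longrightarrow> (\<lambda>n. g n x) \<longlonglongrightarrow> (if x \<in> {-pi..pi} then u x else 0)"
    unfolding measurable_on_def by blast
  have L: "L \<ge> 0" using bd[of 0] by linarith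
  define h where "h = (\<lambda>n \<theta>. max (-L) (min L (g n \<theta>)))"
  define f where "f = (\<lambda>(n::nat) s. min 1 (real n * cmod (s + 1)) * h n (Arg s))"
  have hb: "\<bar>h n \<theta>\<bar> \<le> L" for n \<theta> using L by (auto simp: h_def)
  have fb: "\<bar>f n s\<bar> \<le> L" for n s
  proof -
    have m: "\<bar>min 1 (real n * cmod (s + 1))\<bar> \<le> 1"
    proof -
      have "\<bar>min 1 x\<bar> \<le> 1" if "x \<ge> 0" for x :: real using that by (auto simp: min_def)
      thus ?thesis by simp
    qed
    have "\<bar>f n s\<bar> = \<bar>min 1 (real n * cmod (s + 1))\<bar> * \<bar>h n (Arg s)\<bar>"
      unfolding f_def by (rule abs_mult)
    also have "\<dots> \<le> 1 * L" by (intro mult_mono m hb) auto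
    finally show ?thesis by simp
  qed
  have "continuous_on (sphere 0 1) (f n)" for n
    unfolding f_def using hb
    by (intro continuous_on_circle_pullback) (auto simp: h_def intro!: continuous_intros g)
  hence "\<exists>q. \<forall>s. cmod s = 1 \<longrightarrow> \<bar>f n s - Re (poly q s)\<bar> < 1 / (real n + 1)" for n
    by (intro continuous_circle_approx) auto
  then obtain Q where Q: "\<And>n s. cmod s = 1 \<Longrightarrow> \<bar>f n s - Re (poly (Q n) s)\<bar> < 1 / (real n + 1)"
    by metis
  show ?thesis
  proof (intro exI[of _ Q] conjI allI impI)
    fix n and s :: complex assume "cmod s = 1"
    have "1 / (real n + 1) \<le> 1" by simp
    thus "\<bar>Re (poly (Q n) s)\<bar> \<le> L + 1" using Q[OF \<open>cmod s = 1\<close>, of n] fb[of n s] by linarith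
  next
    have lim': "(\<lambda>n. Re (poly (Q n) (cis \<theta>))) \<longlonglongrightarrow> u \<theta>" if \<theta>: "\<theta> \<notin> N" "-pi < \<theta>" "\<theta> < pi" for \<theta>
    proof -
      have Arg: "Arg (cis \<theta>) = \<theta>" using \<theta> by (intro Arg_cis) auto
      have ne: "cis \<theta> + 1 \<noteq> 0"
      proof
        assume "cis \<theta> + 1 = 0"
        hence "cis \<theta> = -1" by (simp add: add_eq_0_iff2)
        hence "Arg (cis \<theta>) = Arg (cis pi)" by simp
        also have "\<dots> = pi" by (rule Arg_cis) auto
        finally show False using Arg \<theta> by simp
      qed
      hence "filterlim (\<lambda>n. real n * cmod (cis \<theta> + 1)) at_top sequentially"
        by (intro filterlim_at_top_mult_tendsto_pos[OF tendsto_const] filterlim_real_sequentially) auto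
      hence "\<forall>\<^sub>F n in sequentially. real n * cmod (cis \<theta> + 1) \<ge> 1" by (simp add: filterlim_at_top)
      hence ev: "\<forall>\<^sub>F n in sequentially. h n \<theta> = f n (cis \<theta>)"
        by eventually_elim (simp add: f_def Arg)
      have "(\<lambda>n. g n \<theta>) \<longlonglongrightarrow> u \<theta>" using lim[OF \<theta>(1)] \<theta> by simp
      hence "(\<lambda>n. h n \<theta>) \<longlonglongrightarrow> max (-L) (min L (u \<theta>))" unfolding h_def by (intro tendsto_intros)
      also have "max (-L) (min L (u \<theta>)) = u \<theta>" using bd[of \<theta>] by auto
      finally have 1: "(\<lambda>n. f n (cis \<theta>)) \<longlonglongrightarrow> u \<theta>" using ev by (simp add: tendsto_cong)
      have "(\<lambda>n. f n (cis \<theta>) - Re (poly (Q n) (cis \<theta>))) \<longlonglongrightarrow> 0"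
      proof (rule Lim_null_comparison)
        show "\<forall>\<^sub>F n in sequentially. norm (f n (cis \<theta>) - Re (poly (Q n) (cis \<theta>))) \<le> 1 / (real n + 1)"
          using Q[of "cis \<theta>"] by (auto intro!: always_eventually less_imp_le)
        show "(\<lambda>n. 1 / (real n + 1)) \<longlonglongrightarrow> 0" by real_asymp
      qed
      from tendsto_diff[OF 1 this] show ?thesis by simp
    qed
    have "negligible (N \<union> {-pi, pi})" using N by simp
    hence "AE \<theta> in lebesgue. \<theta> \<notin> N \<union> {-pi, pi}" unfolding negligible_iff_null_sets by (rule AE_not_in)
    hence "AE \<theta> in lebesgue. \<theta> \<in> {-pi..pi} \<longrightarrow> (\<lambda>n. Re (poly (Q n) (cis \<theta>))) \<longlonglongrightarrow> u \<theta>"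
      by eventually_elim (auto intro!: lim' simp: less_le)
    thus "AE \<theta> in arc_measure. (\<lambda>n. Re (poly (Q n) (cis \<theta>))) \<longlonglongrightarrow> u \<theta>"
      by (subst AE_restrict_space_iff) auto
  qed
qed

lemma exp_poly_approx:
  fixes p :: "complex poly"
  assumes "e > 0"
  shows "\<exists>s. \<forall>z. cmod z \<le> 1 \<longrightarrow> cmod (poly s z - exp (poly p z)) < e"
proof -
  have "bounded (poly p ` cball 0 1)"
    by (intro compact_imp_bounded compact_continuous_image continuous_intros) auto
  then obtain B where "\<forall>x\<in>poly p ` cball 0 1. cmod x \<le> B"
    unfolding bounded_iff by blast
  hence B: "cmod (poly p z) \<le> B" if "cmod z \<le> 1" for z
    using that by simp
  have "uniform_limit (cball 0 1) (\<lambda>n z. \<Sum>i<n. poly p z ^ i /\<^sub>R fact i) (\<lambda>z. \<Sum>i. poly p z ^ i /\<^sub>R fact i) sequentially"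
  proof (rule Weierstrass_m_test)
    show "summable (\<lambda>n. inverse (fact n) * B ^ n)" by (rule summable_exp)
    show "norm (poly p z ^ n /\<^sub>R fact n) \<le> inverse (fact n) * B ^ n" if "z \<in> cball 0 1" for n z
      using that B by (auto simp: norm_power intro!: mult_left_mono power_mono)
  qed
  from uniform_limitD[OF this \<open>e > 0\<close>]
  have "\<forall>\<^sub>F n in sequentially. \<forall>z\<in>cball 0 1. dist (\<Sum>i<n. poly p z ^ i /\<^sub>R fact i) (exp (poly p z)) < e"
    unfolding exp_def .
  then obtain n where n: "\<And>z. z \<in> cball 0 1 \<Longrightarrow> dist (\<Sum>i<n. poly p z ^ i /\<^sub>R fact i) (exp (poly p z)) < e"
    unfolding eventually_sequentially by blast
  have "poly (\<Sum>i<n. smult (inverse (fact i)) (p ^ i)) z = (\<Sum>i<n. poly p z ^ i /\<^sub>R fact i)" for z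
    by (simp add: poly_sum scaleR_conv_of_real)
  thus ?thesis using n by (intro exI[of _ "\<Sum>i<n. smult (inverse (fact i)) (p ^ i)"]) (auto simp: dist_norm)
qed

lemma exp_near_one:
  assumes "(e::real) > 0"
  obtains d where "d > 0" "\<And>w::complex. cmod w \<le> d \<Longrightarrow> cmod (exp w - 1) < e"
proof -
  have "isCont exp (0::complex)" by (intro continuous_intros)
  then obtain d where d: "d > 0" "\<And>w::complex. dist w 0 < d \<Longrightarrow> dist (exp w) (exp 0) < e"
    using assms unfolding continuous_at_eps_delta by blast
  show thesis
    by (rule that[of "d / 2"]) (use d in \<open>auto simp: dist_norm\<close>)
qed

context szego_weight
begin

text \<open>Truncating \<open>ln W\<close> at a height \<open>k\<close> above and below is harmless for both quantities. In the second one,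
  \<open>exp (- u) * W\<close> exceeds 1 only where \<open>W\<close> exceeds \<open>exp k\<close>, and there it is \<open>exp (- k) * W\<close>. Only the
  excess over 1 is controlled: where \<open>W\<close> is tiny, \<open>exp (- u) * W\<close> need not be close to 1, but a weight
  that is too small only helps an upper bound for a norm.\<close>
lemma truncated_log_approx:
  assumes "e > 0"
  obtains u L where "u \<in> borel_measurable arc_measure" "\<And>\<theta>. \<bar>u \<theta>\<bar> \<le> L"
    "(LINT \<theta>|arc_measure. \<bar>u \<theta> - ln (W \<theta>)\<bar>) < e"
    "(LINT \<theta>|arc_measure. max 0 (exp (- u \<theta>) * W \<theta> - 1)) < e"
proof -
  define u where "u = (\<lambda>(k::nat) \<theta>. max (- real k) (min (real k) (ln (W \<theta>))))"
  have [measurable]: "u k \<in> borel_measurable arc_measure" for k unfolding u_def by measurable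
  have ub: "\<bar>u k \<theta>\<bar> \<le> real k" for k \<theta> by (auto simp: u_def)
  have "(\<lambda>k. LINT \<theta>|arc_measure. \<bar>u k \<theta> - ln (W \<theta>)\<bar>) \<longlonglongrightarrow> (LINT \<theta>|arc_measure. 0)"
  proof (rule integral_dominated_convergence[where w = "\<lambda>\<theta>. \<bar>ln (W \<theta>)\<bar>"])
    show "integrable arc_measure (\<lambda>\<theta>. \<bar>ln (W \<theta>)\<bar>)" using lnW_integrable by simp
    show "AE \<theta> in arc_measure. (\<lambda>k. \<bar>u k \<theta> - ln (W \<theta>)\<bar>) \<longlonglongrightarrow> 0"
    proof (rule AE_I2)
      fix \<theta>
      obtain N :: nat where "\<bar>ln (W \<theta>)\<bar> \<le> real N" using real_arch_simple by blast
      hence "\<bar>u k \<theta> - ln (W \<theta>)\<bar> = 0" if "k \<ge> N" for k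
        using that unfolding u_def by (auto simp: max_def min_def)
      thus "(\<lambda>k. \<bar>u k \<theta> - ln (W \<theta>)\<bar>) \<longlonglongrightarrow> 0"
        by (intro tendsto_eventually eventually_sequentiallyI)
    qed
    show "AE \<theta> in arc_measure. norm \<bar>u k \<theta> - ln (W \<theta>)\<bar> \<le> \<bar>ln (W \<theta>)\<bar>" for k
      by (intro AE_I2) (auto simp: u_def max_def min_def)
  qed measurable
  hence 1: "\<forall>\<^sub>F k in sequentially. (LINT \<theta>|arc_measure. \<bar>u k \<theta> - ln (W \<theta>)\<bar>) < e"
    using \<open>e > 0\<close> by (intro order_tendstoD(2)) simp_all
  have le: "(LINT \<theta>|arc_measure. max 0 (exp (- u k \<theta>) * W \<theta> - 1)) \<le> exp (- real k) * (LINT \<theta>|arc_measure. W \<theta>)" for k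
  proof -
    have pt: "max 0 (exp (- u k \<theta>) * W \<theta> - 1) \<le> exp (- real k) * W \<theta>" if "W \<theta> > 0" for \<theta>
    proof (cases "ln (W \<theta>) \<le> real k")
      case True
      hence "- u k \<theta> \<le> - ln (W \<theta>)" by (auto simp: u_def)
      hence "exp (- u k \<theta>) * W \<theta> \<le> exp (- ln (W \<theta>)) * W \<theta>" using that by (intro mult_right_mono) auto
      also have "\<dots> = 1" using that by (simp add: exp_minus)
      finally show ?thesis using that by simp
    next
      case False
      hence "u k \<theta> = real k" by (auto simp: u_def)
      thus ?thesis using that by simp
    qed
    have "(LINT \<theta>|arc_measure. max 0 (exp (- u k \<theta>) * W \<theta> - 1)) \<le> (LINT \<theta>|arc_measure. exp (- real k) * W \<theta>)"
    proof (rule integral_mono_AE)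
      show i: "integrable arc_measure (\<lambda>\<theta>. exp (- real k) * W \<theta>)" using W_integrable by simp
      show ae: "AE \<theta> in arc_measure. max 0 (exp (- u k \<theta>) * W \<theta> - 1) \<le> exp (- real k) * W \<theta>"
        using W_pos by eventually_elim (rule pt)
      show "integrable arc_measure (\<lambda>\<theta>. max 0 (exp (- u k \<theta>) * W \<theta> - 1))"
      proof (rule Bochner_Integration.integrable_bound[OF i])
        show "AE \<theta> in arc_measure. norm (max 0 (exp (- u k \<theta>) * W \<theta> - 1)) \<le> norm (exp (- real k) * W \<theta>)"
          using W_pos by eventually_elim (use pt in auto)
      qed measurable
    qed
    thus ?thesis by simp
  qed
  have "(\<lambda>k. exp (- real k) * (LINT \<theta>|arc_measure. W \<theta>)) \<longlonglongrightarrow> 0 * (LINT \<theta>|arc_measure. W \<theta>)"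
    by (intro tendsto_intros) real_asymp
  hence "\<forall>\<^sub>F k in sequentially. exp (- real k) * (LINT \<theta>|arc_measure. W \<theta>) < e"
    using \<open>e > 0\<close> by (intro order_tendstoD(2)) simp_all
  with 1 have "\<forall>\<^sub>F k in sequentially. (LINT \<theta>|arc_measure. \<bar>u k \<theta> - ln (W \<theta>)\<bar>) < e \<and>
      (LINT \<theta>|arc_measure. max 0 (exp (- u k \<theta>) * W \<theta> - 1)) < e"
    by eventually_elim (use le order.strict_trans1 in blast)
  then obtain k where "(LINT \<theta>|arc_measure. \<bar>u k \<theta> - ln (W \<theta>)\<bar>) < e"
      "(LINT \<theta>|arc_measure. max 0 (exp (- u k \<theta>) * W \<theta> - 1)) < e"
    unfolding eventually_sequentially by blast
  thus thesis using ub that[of "u k" "real k"] by simp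
qed

lemma circle_poly_measurable [measurable]: "(\<lambda>\<theta>. poly p (cis \<theta>)) \<in> borel_measurable arc_measure"
  by (intro continuous_imp_measurable_on_sets_lebesgue continuous_intros) auto

lemma log_weight_poly_approx:
  assumes "e > 0"
  obtains Q where "(LINT \<theta>|arc_measure. \<bar>Re (poly Q (cis \<theta>)) - ln (W \<theta>)\<bar>) < e"
    "(LINT \<theta>|arc_measure. max 0 (exp (- Re (poly Q (cis \<theta>))) * W \<theta> - 1)) < e"
proof -
  obtain u L where [measurable]: "u \<in> borel_measurable arc_measure" and uL: "\<And>\<theta>. \<bar>u \<theta>\<bar> \<le> L"
    and u: "(LINT \<theta>|arc_measure. \<bar>u \<theta> - ln (W \<theta>)\<bar>) < e"
    "(LINT \<theta>|arc_measure. max 0 (exp (- u \<theta>) * W \<theta> - 1)) < e"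
    using truncated_log_approx[OF assms] by blast
  obtain Q where Qb: "\<And>n s. cmod s = 1 \<Longrightarrow> \<bar>Re (poly (Q n) s)\<bar> \<le> L + 1"
    and Qlim: "AE \<theta> in arc_measure. (\<lambda>n. Re (poly (Q n) (cis \<theta>))) \<longlonglongrightarrow> u \<theta>"
    using bounded_measurable_circle_approx[of u L] uL by auto
  have "(\<lambda>n. LINT \<theta>|arc_measure. \<bar>Re (poly (Q n) (cis \<theta>)) - ln (W \<theta>)\<bar>) \<longlonglongrightarrow>
        (LINT \<theta>|arc_measure. \<bar>u \<theta> - ln (W \<theta>)\<bar>)"
  proof (rule integral_dominated_convergence[where w = "\<lambda>\<theta>. L + 1 + \<bar>ln (W \<theta>)\<bar>"])
    show "integrable arc_measure (\<lambda>\<theta>. L + 1 + \<bar>ln (W \<theta>)\<bar>)" using lnW_integrable by simp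
    show "AE \<theta> in arc_measure. (\<lambda>n. \<bar>Re (poly (Q n) (cis \<theta>)) - ln (W \<theta>)\<bar>) \<longlonglongrightarrow> \<bar>u \<theta> - ln (W \<theta>)\<bar>"
      using Qlim by eventually_elim (intro tendsto_intros)
    show "AE \<theta> in arc_measure. norm \<bar>Re (poly (Q n) (cis \<theta>)) - ln (W \<theta>)\<bar> \<le> L + 1 + \<bar>ln (W \<theta>)\<bar>" for n
    proof (rule AE_I2)
      fix \<theta>
      show "norm \<bar>Re (poly (Q n) (cis \<theta>)) - ln (W \<theta>)\<bar> \<le> L + 1 + \<bar>ln (W \<theta>)\<bar>"
        using Qb[of "cis \<theta>" n] unfolding real_norm_def abs_idempotent norm_cis by linarith
    qed
  qed measurable
  hence 1: "\<forall>\<^sub>F n in sequentially. (LINT \<theta>|arc_measure. \<bar>Re (poly (Q n) (cis \<theta>)) - ln (W \<theta>)\<bar>) < e"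
    using u(1) by (rule order_tendstoD(2))
  have "(\<lambda>n. LINT \<theta>|arc_measure. max 0 (exp (- Re (poly (Q n) (cis \<theta>))) * W \<theta> - 1)) \<longlonglongrightarrow>
        (LINT \<theta>|arc_measure. max 0 (exp (- u \<theta>) * W \<theta> - 1))"
  proof (rule integral_dominated_convergence[where w = "\<lambda>\<theta>. exp (L + 1) * W \<theta>"])
    show "integrable arc_measure (\<lambda>\<theta>. exp (L + 1) * W \<theta>)" using W_integrable by simp
    show "AE \<theta> in arc_measure. (\<lambda>n. max 0 (exp (- Re (poly (Q n) (cis \<theta>))) * W \<theta> - 1)) \<longlonglongrightarrow>
        max 0 (exp (- u \<theta>) * W \<theta> - 1)"
      using Qlim by eventually_elim (intro tendsto_intros)
    show "AE \<theta> in arc_measure. norm (max 0 (exp (- Re (poly (Q n) (cis \<theta>))) * W \<theta> - 1)) \<le> exp (L + 1) * W \<theta>" for n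
    proof (rule AE_I2)
      fix \<theta> assume "\<theta> \<in> space arc_measure"
      hence W: "W \<theta> \<ge> 0" using W_nonneg by simp
      have "- Re (poly (Q n) (cis \<theta>)) \<le> L + 1" using Qb[of "cis \<theta>" n] unfolding norm_cis by linarith
      hence "exp (- Re (poly (Q n) (cis \<theta>))) * W \<theta> \<le> exp (L + 1) * W \<theta>"
        using W by (intro mult_right_mono) auto
      moreover have "0 \<le> exp (L + 1) * W \<theta>" using W by simp
      ultimately show "norm (max 0 (exp (- Re (poly (Q n) (cis \<theta>))) * W \<theta> - 1)) \<le> exp (L + 1) * W \<theta>"
        by (simp add: max_def)
    qed
  qed measurable
  hence "\<forall>\<^sub>F n in sequentially. (LINT \<theta>|arc_measure. max 0 (exp (- Re (poly (Q n) (cis \<theta>))) * W \<theta> - 1)) < e"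
    using u(2) by (rule order_tendstoD(2))
  with 1 have "\<forall>\<^sub>F n in sequentially. (LINT \<theta>|arc_measure. \<bar>Re (poly (Q n) (cis \<theta>)) - ln (W \<theta>)\<bar>) < e \<and>
      (LINT \<theta>|arc_measure. max 0 (exp (- Re (poly (Q n) (cis \<theta>))) * W \<theta> - 1)) < e"
    by (rule eventually_conj)
  thus thesis using that unfolding eventually_sequentially by blast
qed

text \<open>The integrand lies between 0 and \<open>|f W|\<close>.\<close>
lemma integrable_excess:
  assumes "continuous_on (sphere 0 1) (f :: complex \<Rightarrow> real)"
  shows "integrable arc_measure (\<lambda>\<theta>. max 0 (f (cis \<theta>) * W \<theta> - 1))"
proof (rule Bochner_Integration.integrable_bound)
  have i: "integrable arc_measure (\<lambda>\<theta>. f (cis \<theta>) * W \<theta>)"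
    using integral_\<mu>(2)[OF assms] by (simp add: mult.commute)
  show "integrable arc_measure (\<lambda>\<theta>. \<bar>f (cis \<theta>) * W \<theta>\<bar>)" using i by simp
  have [measurable]: "(\<lambda>\<theta>. f (cis \<theta>) * W \<theta>) \<in> borel_measurable arc_measure" using i by auto
  show "(\<lambda>\<theta>. max 0 (f (cis \<theta>) * W \<theta> - 1)) \<in> borel_measurable arc_measure" by measurable
qed (auto intro!: AE_I2)

lemma D_nonzero [simp]: "D z \<noteq> 0" by (simp add: szego_function_eq)

lemma inverse_D_bound:
  assumes "r < 1"
  obtains B where "B > 0" "\<And>z. cmod z \<le> r \<Longrightarrow> cmod (1 / D z) \<le> B"
proof
  define C where "C = (LINT \<theta>|arc_measure. \<bar>ln (W \<theta>)\<bar>) / (2 * pi * (1 - r))"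
  show "exp C > 0" by simp
  show "cmod (1 / D z) \<le> exp C" if "cmod z \<le> r" for z
  proof -
    have "1 / D z = exp (- herglotz (\<lambda>\<theta>. ln (W \<theta>)) z)" by (simp add: szego_function_eq exp_minus divide_inverse)
    also have "cmod \<dots> \<le> exp (cmod (herglotz (\<lambda>\<theta>. ln (W \<theta>)) z))"
      using norm_exp[of "- herglotz (\<lambda>\<theta>. ln (W \<theta>)) z"] by simp
    also have "\<dots> \<le> exp C" using norm_herglotz_le[OF lnW_integrable that assms] by (simp add: C_def)
    finally show ?thesis .
  qed
qed

text \<open>For a polynomial \<open>Q\<close> that is real at the origin, the Schwarz formula identifies \<open>exp (- Q / 2)\<close> with
  the exponential of minus the Herglotz integral of \<open>T = Re Q\<close>. Hence it is close to \<open>1 / D\<close> on compact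
  subsets of the disc when \<open>T\<close> is close to \<open>ln W\<close> in mean, while on the circle its squared modulus is
  \<open>exp (- T)\<close>. A polynomial close to \<open>exp (- Q / 2)\<close> on the closed disc inherits both properties.\<close>
lemma inverse_D_poly_approx:
  assumes "r < 1" and e: "e > 0"
  obtains s where "\<And>z. cmod z \<le> r \<Longrightarrow> cmod (poly s z - 1 / D z) \<le> e"
    "(LINT \<theta>|arc_measure. max 0 ((cmod (poly s (cis \<theta>)))\<^sup>2 * W \<theta> - 1)) \<le> e"
proof -
  obtain B where B: "B > 0" "\<And>z. cmod z \<le> r \<Longrightarrow> cmod (1 / D z) \<le> B"
    using inverse_D_bound[OF \<open>r < 1\<close>] by blast
  obtain d where d: "d > 0" "\<And>w::complex. cmod w \<le> d \<Longrightarrow> cmod (exp w - 1) < e / (2 * B)"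
    using exp_near_one[of "e / (2 * B)"] B(1) e by auto
  \<comment> \<open>The second bound makes the Herglotz integral of \<open>T - ln W\<close> at most \<open>d\<close> on the disc of radius \<open>r\<close>.\<close>
  define e' where "e' = min (e / 2) (d * (2 * pi * (1 - r)))"
  have "e' > 0" using e d(1) \<open>r < 1\<close> by (simp add: e'_def)
  then obtain Q0 where Q0: "(LINT \<theta>|arc_measure. \<bar>Re (poly Q0 (cis \<theta>)) - ln (W \<theta>)\<bar>) < e'"
    "(LINT \<theta>|arc_measure. max 0 (exp (- Re (poly Q0 (cis \<theta>))) * W \<theta> - 1)) < e'"
    using log_weight_poly_approx by blast
  \<comment> \<open>The imaginary constant does not change the real part;
      it normalises the phase of \<open>exp (- Q / 2)\<close> to that of \<open>1 / D\<close>.\<close>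
  define Q where "Q = Q0 - [:\<i> * complex_of_real (Im (poly Q0 0)):]"
  define T where "T = (\<lambda>\<theta>. Re (poly Q (cis \<theta>)))"
  have T: "T \<theta> = Re (poly Q0 (cis \<theta>))" for \<theta> by (simp add: T_def Q_def)
  have Ti: "integrable arc_measure T"
    unfolding T_def by (intro integrable_arc_circle continuous_intros)
  define E where "E = (\<lambda>z. exp (poly (smult (- 1 / 2) Q) z))"
  have E_eq: "E z = exp (- herglotz T z)" if "cmod z < 1" for z
  proof -
    have "herglotz T z = (poly Q z - \<i> * Im (poly Q 0)) / 2"
      unfolding T_def by (rule schwarz_formula[of "poly Q" 2 z]) (use that in \<open>auto intro!: holomorphic_intros\<close>)
    moreover have "Im (poly Q 0) = 0" by (simp add: Q_def)
    ultimately have "herglotz T z = poly Q z / 2" by simp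
    show ?thesis unfolding E_def \<open>herglotz T z = poly Q z / 2\<close> by simp
  qed
  have E_near: "cmod (E z - 1 / D z) \<le> e / 2" if z: "cmod z \<le> r" for z
  proof -
    have z1: "cmod z < 1" using z \<open>r < 1\<close> by simp
    define w where "w = - herglotz (\<lambda>\<theta>. T \<theta> - ln (W \<theta>)) z"
    have "cmod w \<le> (LINT \<theta>|arc_measure. \<bar>T \<theta> - ln (W \<theta>)\<bar>) / (2 * pi * (1 - r))"
      unfolding w_def norm_minus_cancel by (intro norm_herglotz_le Bochner_Integration.integrable_diff Ti lnW_integrable z \<open>r < 1\<close>)
    also have "\<dots> \<le> e' / (2 * pi * (1 - r))"
      using Q0(1) \<open>r < 1\<close> by (intro divide_right_mono) (auto simp: T)
    also have "\<dots> \<le> d" using \<open>r < 1\<close> by (simp add: e'_def pos_divide_le_eq)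
    finally have w: "cmod w \<le> d" .
    have "E z - 1 / D z = 1 / D z * (exp w - 1)"
    proof -
      have "E z = exp (- herglotz (\<lambda>\<theta>. ln (W \<theta>)) z + w)"
        unfolding E_eq[OF z1] w_def herglotz_diff[OF Ti lnW_integrable z1] by simp
      also have "\<dots> = 1 / D z * exp w" by (simp only: exp_add exp_minus szego_function_eq divide_inverse mult_1_left)
      finally show ?thesis by (simp only: right_diff_distrib mult_1_right)
    qed
    hence "cmod (E z - 1 / D z) = cmod (1 / D z) * cmod (exp w - 1)" by (simp only: norm_mult)
    also have "\<dots> \<le> B * (e / (2 * B))" using B(2)[OF z] d(2)[OF w] B(1) by (intro mult_mono) auto
    also have "\<dots> = e / 2" using B(1) by simp
    finally show ?thesis .
  qed
  have absE: "(cmod (E (cis \<theta>)))\<^sup>2 = exp (- T \<theta>)" for \<theta>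
    by (simp add: E_def T_def flip: exp_double)
  have contE: "continuous_on A E" for A unfolding E_def by (intro continuous_intros)
  have "bounded (E ` cball 0 1)"
    by (intro compact_imp_bounded compact_continuous_image contE) auto
  then obtain C where "\<forall>x\<in>E ` cball 0 1. cmod x \<le> C" unfolding bounded_iff by blast
  hence C: "cmod (E z) \<le> C" if "cmod z \<le> 1" for z using that by simp
  have C0: "C \<ge> 0" using order_trans[OF norm_ge_zero C[of 0]] by simp
  define J where "J = (LINT \<theta>|arc_measure. W \<theta>)"
  have J: "J \<ge> 0" unfolding J_def using W_nonneg by (intro integral_nonneg_AE AE_I2) auto
  \<comment> \<open>Chosen so that replacing \<open>E\<close> by a polynomial costs at most \<open>e / 2\<close> in both
      estimates; \<open>2 * C + 1\<close> bounds \<open>2 * |E| + \<eta>\<close>.\<close>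
  define \<eta> where "\<eta> = min 1 (min (e / 2) (e / (2 * (2 * C + 1) * (J + 1))))"
  have \<eta>: "\<eta> > 0" using e C0 J by (simp add: \<eta>_def)
  obtain s where s: "\<And>z. cmod z \<le> 1 \<Longrightarrow> cmod (poly s z - E z) < \<eta>"
    using exp_poly_approx[OF \<eta>, of "smult (- 1 / 2) Q"] unfolding E_def by blast
  have sE: "(cmod (poly s z))\<^sup>2 \<le> (cmod (E z))\<^sup>2 + \<eta> * (2 * C + 1)" if "cmod z \<le> 1" for z
  proof -
    have "cmod (poly s z) \<le> cmod (E z) + \<eta>"
      using s[OF that] norm_triangle_ineq2[of "poly s z" "E z"] by simp
    hence "(cmod (poly s z))\<^sup>2 \<le> (cmod (E z) + \<eta>)\<^sup>2" by (intro power_mono) auto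
    also have "\<dots> = (cmod (E z))\<^sup>2 + \<eta> * (2 * cmod (E z) + \<eta>)" by (simp add: power2_eq_square algebra_simps)
    also have "\<dots> \<le> (cmod (E z))\<^sup>2 + \<eta> * (2 * C + 1)"
      using C[OF that] \<eta> by (intro add_left_mono mult_left_mono) (auto simp: \<eta>_def)
    finally show ?thesis .
  qed
  show thesis
  proof (rule that[of s])
    fix z assume z: "cmod z \<le> r"
    have "cmod (poly s z - 1 / D z) \<le> cmod (poly s z - E z) + cmod (E z - 1 / D z)"
      using norm_triangle_ineq[of "poly s z - E z" "E z - 1 / D z"] by simp
    also have "\<dots> \<le> e / 2 + e / 2"
      using s[of z] E_near[OF z] z \<open>r < 1\<close> by (intro add_mono) (auto simp: \<eta>_def)
    finally show "cmod (poly s z - 1 / D z) \<le> e" by simp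
  next
    have i1: "integrable arc_measure (\<lambda>\<theta>. max 0 ((cmod (poly s (cis \<theta>)))\<^sup>2 * W \<theta> - 1))"
      by (rule integrable_excess) (intro continuous_intros)
    have i2: "integrable arc_measure (\<lambda>\<theta>. max 0 ((cmod (E (cis \<theta>)))\<^sup>2 * W \<theta> - 1))"
      by (rule integrable_excess) (intro continuous_intros contE)
    have "(LINT \<theta>|arc_measure. max 0 ((cmod (poly s (cis \<theta>)))\<^sup>2 * W \<theta> - 1)) \<le>
          (LINT \<theta>|arc_measure. max 0 ((cmod (E (cis \<theta>)))\<^sup>2 * W \<theta> - 1) + \<eta> * (2 * C + 1) * W \<theta>)"
    proof (rule integral_mono)
      fix \<theta> assume "\<theta> \<in> space arc_measure"
      hence W: "W \<theta> \<ge> 0" using W_nonneg by simp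
      have "(cmod (poly s (cis \<theta>)))\<^sup>2 * W \<theta> \<le> ((cmod (E (cis \<theta>)))\<^sup>2 + \<eta> * (2 * C + 1)) * W \<theta>"
        by (intro mult_right_mono sE W) simp
      moreover have "\<eta> * (2 * C + 1) * W \<theta> \<ge> 0" using \<eta> C0 W by simp
      ultimately show "max 0 ((cmod (poly s (cis \<theta>)))\<^sup>2 * W \<theta> - 1)
          \<le> max 0 ((cmod (E (cis \<theta>)))\<^sup>2 * W \<theta> - 1) + \<eta> * (2 * C + 1) * W \<theta>"
        by (simp add: distrib_right)
    qed (use i1 i2 W_integrable in auto)
    also have "\<dots> = (LINT \<theta>|arc_measure. max 0 ((cmod (E (cis \<theta>)))\<^sup>2 * W \<theta> - 1)) + \<eta> * (2 * C + 1) * J"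
      using i2 W_integrable by (simp add: J_def)
    also have "\<dots> \<le> e / 2 + e / 2"
    proof (rule add_mono)
      show "(LINT \<theta>|arc_measure. max 0 ((cmod (E (cis \<theta>)))\<^sup>2 * W \<theta> - 1)) \<le> e / 2"
        using Q0(2) by (simp add: absE T e'_def)
      have "\<eta> * ((2 * C + 1) * J) \<le> e / (2 * (2 * C + 1) * (J + 1)) * ((2 * C + 1) * (J + 1))"
        using C0 J e by (intro mult_mono) (auto simp: \<eta>_def)
      also have "\<dots> = e / 2"
      proof -
        have "(2 * C + 1) * (J + 1) \<noteq> 0" using C0 J by simp
        moreover have "e / (2 * x) * x = e / 2" if "x \<noteq> 0" for x using that by simp
        ultimately show ?thesis by (simp only: mult.assoc)
      qed
      finally show "\<eta> * (2 * C + 1) * J \<le> e / 2" by (simp add: mult.assoc)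
    qed
    finally show "(LINT \<theta>|arc_measure. max 0 ((cmod (poly s (cis \<theta>)))\<^sup>2 * W \<theta> - 1)) \<le> e" by simp
  qed
qed

end

section \<open>Convergence on the bidisc\<close>

text \<open>One radius for both variables suffices, since every compact subset of the product of two open unit
  discs lies in such a product of closed discs.\<close>

definition bidisc_limit ::
    "(nat \<Rightarrow> complex \<Rightarrow> complex \<Rightarrow> complex) \<Rightarrow> (complex \<Rightarrow> complex \<Rightarrow> complex) \<Rightarrow> bool" where
  "bidisc_limit f g \<longleftrightarrow> (\<forall>r<1. uniform_limit (cball 0 r \<times> cball 0 r)
     (\<lambda>n (z, w). f n z w) (\<lambda>(z, w). g z w) sequentially)"

lemma bidisc_limit_iff:
  "bidisc_limit f g \<longleftrightarrow> (\<forall>r<1. \<forall>e>0. \<forall>\<^sub>F n in sequentially.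
     \<forall>z w. cmod z \<le> r \<longrightarrow> cmod w \<le> r \<longrightarrow> cmod (f n z w - g z w) < e)"
  unfolding bidisc_limit_def uniform_limit_iff by (simp add: dist_norm Ball_def imp_conjL)

text \<open>Kernels are Hermitian, so this carries a statement on derivatives in the first variable over to
  derivatives in the conjugate of the second one.\<close>
lemma bidisc_limit_cnj_swap:
  assumes "bidisc_limit f g"
  shows "bidisc_limit (\<lambda>n z w. cnj (f n w z)) (\<lambda>z w. cnj (g w z))"
  unfolding bidisc_limit_iff
proof (intro allI impI)
  fix r e :: real assume "r < 1" "e > 0"
  hence "\<forall>\<^sub>F n in sequentially. \<forall>z w. cmod z \<le> r \<longrightarrow> cmod w \<le> r \<longrightarrow> cmod (f n z w - g z w) < e"
    using assms unfolding bidisc_limit_iff by blast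
  thus "\<forall>\<^sub>F n in sequentially. \<forall>z w. cmod z \<le> r \<longrightarrow> cmod w \<le> r \<longrightarrow> cmod (cnj (f n w z) - cnj (g w z)) < e"
    unfolding complex_cnj_diff[symmetric] complex_mod_cnj by (rule eventually_mono) blast
qed

text \<open>Cauchy's estimate for the derivative of the difference, on discs of radius \<open>d\<close> around points of
  the disc of radius \<open>r\<close>, which lie in the disc of radius \<open>r + d < 1\<close>.\<close>
lemma bidisc_limit_deriv:
  assumes lim: "bidisc_limit f g"
    and f: "\<And>n w. w \<in> ball 0 1 \<Longrightarrow> (\<lambda>z. f n z w) holomorphic_on ball 0 1"
    and g: "\<And>w. w \<in> ball 0 1 \<Longrightarrow> (\<lambda>z. g z w) holomorphic_on ball 0 1"
  shows "bidisc_limit (\<lambda>n z w. deriv (\<lambda>z. f n z w) z) (\<lambda>z w. deriv (\<lambda>z. g z w) z)"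
  unfolding bidisc_limit_iff
proof (intro allI impI)
  fix r e :: real assume r: "r < 1" and e: "e > 0"
  define d where "d = (1 - r) / 2"
  have d: "d > 0" "r + d < 1" using r by (simp_all add: d_def field_simps)
  have "\<forall>\<^sub>F n in sequentially. \<forall>z w. cmod z \<le> r + d \<longrightarrow> cmod w \<le> r + d \<longrightarrow> cmod (f n z w - g z w) < e * d / 2"
    using lim[unfolded bidisc_limit_iff, rule_format, OF d(2), of "e * d / 2"] d e by simp
  thus "\<forall>\<^sub>F n in sequentially. \<forall>z w. cmod z \<le> r \<longrightarrow> cmod w \<le> r \<longrightarrow>
      cmod (deriv (\<lambda>z. f n z w) z - deriv (\<lambda>z. g z w) z) < e"
  proof (rule eventually_mono, intro allI impI)
    fix n z w
    assume close: "\<forall>z w. cmod z \<le> r + d \<longrightarrow> cmod w \<le> r + d \<longrightarrow> cmod (f n z w - g z w) < e * d / 2"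
      and z: "cmod z \<le> r" and w: "cmod w \<le> r"
    have w1: "w \<in> ball 0 1" and z1: "z \<in> ball 0 1" using w z r by auto
    have rd: "cmod x \<le> r + d" if "dist z x \<le> d" for x
      using norm_triangle_ineq2[of x z] that z by (simp add: dist_norm norm_minus_commute)
    have sub: "cball z d \<subseteq> ball 0 1" using rd d by fastforce
    have hol: "(\<lambda>z. f n z w - g z w) holomorphic_on ball 0 1"
      by (intro holomorphic_on_diff f g w1)
    have "cmod ((deriv ^^ 1) (\<lambda>z. f n z w - g z w) z) \<le> fact 1 * (e * d / 2) / d ^ 1"
    proof (rule Cauchy_inequality)
      show "(\<lambda>z. f n z w - g z w) holomorphic_on ball z d"
        using hol by (rule holomorphic_on_subset) (use sub ball_subset_cball in blast)
      show "continuous_on (cball z d) (\<lambda>z. f n z w - g z w)"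
        by (rule holomorphic_on_imp_continuous_on[OF holomorphic_on_subset[OF hol sub]])
      show "cmod (f n x w - g x w) \<le> e * d / 2" if "cmod (z - x) = d" for x
        using close rd[of x] that w d by (intro less_imp_le) (auto simp: dist_norm)
    qed (use d in auto)
    also have "(deriv ^^ 1) (\<lambda>z. f n z w - g z w) z = deriv (\<lambda>z. f n z w) z - deriv (\<lambda>z. g z w) z"
      using deriv_diff[OF holomorphic_on_imp_differentiable_at[OF f[OF w1] open_ball z1]
          holomorphic_on_imp_differentiable_at[OF g[OF w1] open_ball z1]] by simp
    finally show "cmod (deriv (\<lambda>z. f n z w) z - deriv (\<lambda>z. g z w) z) < e" using d e by simp
  qed
qed

context szego_weight
begin

section \<open>Trial polynomials close to the limit kernel\<close>

lemma inverse_D_poly_sequence: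
  assumes "r < 1"
  obtains s where "uniform_limit (cball 0 r) (\<lambda>n. poly (s n)) (\<lambda>z. 1 / D z) sequentially"
    "\<And>n. (LINT \<theta>|arc_measure. max 0 ((cmod (poly (s n) (cis \<theta>)))\<^sup>2 * W \<theta> - 1)) \<le> 1 / (real n + 1)"
proof -
  define P where "P = (\<lambda>n s. (\<forall>z. cmod z \<le> r \<longrightarrow> cmod (poly s z - 1 / D z) \<le> 1 / (real n + 1)) \<and>
       (LINT \<theta>|arc_measure. max 0 ((cmod (poly s (cis \<theta>)))\<^sup>2 * W \<theta> - 1)) \<le> 1 / (real n + 1))"
  have "\<exists>s. P n s" for n
    unfolding P_def by (rule inverse_D_poly_approx[OF assms, of "1 / (real n + 1)"]) auto
  then obtain s where "\<And>n. P n (s n)" by metis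
  hence s: "\<And>n z. cmod z \<le> r \<Longrightarrow> cmod (poly (s n) z - 1 / D z) \<le> 1 / (real n + 1)"
    "\<And>n. (LINT \<theta>|arc_measure. max 0 ((cmod (poly (s n) (cis \<theta>)))\<^sup>2 * W \<theta> - 1)) \<le> 1 / (real n + 1)"
    unfolding P_def by blast+
  have "uniform_limit (cball 0 r) (\<lambda>n. poly (s n)) (\<lambda>z. 1 / D z) sequentially"
  proof (rule uniform_limitI)
    fix e :: real assume "e > 0"
    have "(\<lambda>n. 1 / (real n + 1)) \<longlonglongrightarrow> 0" by real_asymp
    from order_tendstoD(2)[OF this \<open>e > 0\<close>]
    show "\<forall>\<^sub>F n in sequentially. \<forall>z\<in>cball 0 r. dist (poly (s n) z) (1 / D z) < e"
    proof eventually_elim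
      case (elim n)
      show ?case
      proof
        fix z :: complex assume "z \<in> cball 0 r"
        thus "dist (poly (s n) z) (1 / D z) < e" using s(1)[of z n] elim by (simp add: dist_norm)
      qed
    qed
  qed
  thus thesis using s(2) by (rule that)
qed

text \<open>A locally uniform limit of polynomials. This spares differentiating under the integral sign in the
  definition of the Szego function.\<close>
lemma inverse_D_holomorphic: "(\<lambda>z. 1 / D z) holomorphic_on ball 0 1"
proof -
  have "(\<lambda>z. 1 / D z) field_differentiable at z" if z: "z \<in> ball 0 1" for z
  proof -
    define r where "r = (1 + cmod z) / 2"
    have r: "cmod z < r" "r < 1" using z by (auto simp: r_def field_simps)
    obtain s where S: "uniform_limit (cball 0 r) (\<lambda>n. poly (s n)) (\<lambda>z. 1 / D z) sequentially"
      and "\<And>n. (LINT \<theta>|arc_measure. max 0 ((cmod (poly (s n) (cis \<theta>)))\<^sup>2 * W \<theta> - 1)) \<le> 1 / (real n + 1)"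
      by (rule inverse_D_poly_sequence[OF r(2)]) (rule that)
    have "(\<lambda>z. 1 / D z) holomorphic_on ball 0 r"
      by (rule holomorphic_uniform_limit[OF _ S]) (auto intro!: always_eventually continuous_intros holomorphic_intros)
    thus ?thesis using r by (intro holomorphic_on_imp_differentiable_at[of _ "ball 0 r"]) auto
  qed
  thus ?thesis unfolding holomorphic_on_def by (blast intro: field_differentiable_at_within)
qed

text \<open>The reproducing kernel of the closure of the polynomials in \<open>L\<^sup>2(\<mu>)\<close>: the kernel of the Hardy space,
  divided by the multiplier \<open>D\<close> in each variable.\<close>
definition szego_kernel :: "complex \<Rightarrow> complex \<Rightarrow> complex" where
  "szego_kernel z w = 1 / D z * cnj (1 / D w) / (1 - z * cnj w)"

lemma szego_kernel_diag:
  "szego_kernel z z = complex_of_real (1 / ((1 - (cmod z)\<^sup>2) * (cmod (D z))\<^sup>2))"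
  using complex_norm_square[of z] complex_norm_square[of "D z"]
  by (simp add: szego_kernel_def mult_ac)

text \<open>The polynomial \<open>s\<close> stands for \<open>1 / D\<close>, and the geometric sum for \<open>1 / (1 - z * cnj w)\<close>.\<close>
definition trial :: "complex poly \<Rightarrow> nat \<Rightarrow> complex \<Rightarrow> complex poly" where
  "trial s n w = smult (cnj (poly s w)) (s * (\<Sum>k<n. monom (cnj w ^ k) k))"

lemma poly_trial:
  assumes "z * cnj w \<noteq> 1"
  shows "poly (trial s n w) z = cnj (poly s w) * poly s z * ((1 - (z * cnj w) ^ n) / (1 - z * cnj w))"
proof -
  have "(\<Sum>k<n. cnj w ^ k * z ^ k) = (\<Sum>k<n. (z * cnj w) ^ k)"
    by (simp add: power_mult_distrib mult.commute)
  also have "\<dots> = (1 - (z * cnj w) ^ n) / (1 - z * cnj w)"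
    using sum_gp_strict[of "z * cnj w" n] assms by simp
  finally show ?thesis by (simp add: trial_def poly_sum poly_monom)
qed

lemma degree_trial: "degree (trial s n w) \<le> degree s + n"
proof -
  have "degree (\<Sum>k<n. monom (cnj w ^ k) k) \<le> n"
    by (intro degree_sum_le) (auto intro: order_trans[OF degree_monom_le])
  thus ?thesis unfolding trial_def
    by (meson degree_smult_le degree_mult_le order_trans add_left_mono)
qed

text \<open>On the circle \<open>|s|\<^sup>2 W\<close> is at most 1 up to an excess with small integral. Without the excess the
  integrand is at most \<open>(1 + r ^ n)\<^sup>2 / |1 - x * cnj w|\<^sup>2\<close> up to the factor \<open>|s w|\<^sup>2\<close>, which is a multiple of
  the Poisson kernel at \<open>w\<close> with a known integral.\<close>
lemma norm_trial_le:
  assumes r: "r < 1" and w: "cmod w \<le> r"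
    and s: "(LINT \<theta>|arc_measure. max 0 ((cmod (poly s (cis \<theta>)))\<^sup>2 * W \<theta> - 1)) \<le> e"
  shows "(LINT x|\<mu>. (cmod (poly (trial s n w) x))\<^sup>2) \<le>
           (cmod (poly s w))\<^sup>2 * (1 + r ^ n)\<^sup>2 * (1 / (1 - (cmod w)\<^sup>2) + e / (2 * pi * (1 - r)\<^sup>2))"
proof -
  define h where "h = (\<lambda>\<theta>. max 0 ((cmod (poly s (cis \<theta>)))\<^sup>2 * W \<theta> - 1))"
  define c where "c = (cmod (poly s w))\<^sup>2 * (1 + r ^ n)\<^sup>2"
  have w1: "cmod w < 1" using r w by simp
  have w2: "1 - (cmod w)\<^sup>2 > 0" using w1 by (simp add: abs_square_less_1)
  have c0: "c \<ge> 0" by (simp add: c_def)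
  have ih: "integrable arc_measure h"
    unfolding h_def by (rule integrable_excess) (intro continuous_intros)
  have ip: "integrable arc_measure (poisson_kernel w)" using integrable_poisson[of "\<lambda>_. 1" w] w1 by simp
  have pt: "W \<theta> * (cmod (poly (trial s n w) (cis \<theta>)))\<^sup>2 \<le>
      c * (poisson_kernel w \<theta> / (1 - (cmod w)\<^sup>2) + h \<theta> / (1 - r)\<^sup>2)" if "\<theta> \<in> {-pi..pi}" for \<theta>
  proof -
    have W: "W \<theta> \<ge> 0" using W_nonneg that by simp
    define q where "q = cmod (1 - cis \<theta> * cnj w)"
    have q: "q = cmod (1 - cnj w * cis \<theta>)" by (simp add: q_def mult.commute)
    have qr: "1 - r \<le> q" unfolding q using norm_one_minus_ge[of "cnj w" r "cis \<theta>"] w by simp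
    have q0: "q > 0" using qr r by simp
    have "cis \<theta> * cnj w \<noteq> 1" using q0 by (auto simp: q_def)
    hence tr: "cmod (poly (trial s n w) (cis \<theta>)) =
        cmod (poly s w) * cmod (poly s (cis \<theta>)) * (cmod (1 - (cis \<theta> * cnj w) ^ n) / q)"
      by (simp add: poly_trial norm_mult norm_divide q_def)
    have "cmod (1 - (cis \<theta> * cnj w) ^ n) \<le> 1 + cmod w ^ n"
      using norm_triangle_ineq4[of 1 "(cis \<theta> * cnj w) ^ n"] by (simp add: norm_mult norm_power)
    also have "\<dots> \<le> 1 + r ^ n" using w by (intro add_left_mono power_mono) auto
    finally have "cmod (poly (trial s n w) (cis \<theta>)) \<le>
        cmod (poly s w) * cmod (poly s (cis \<theta>)) * ((1 + r ^ n) / q)"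
      unfolding tr using q0 by (intro mult_left_mono divide_right_mono) auto
    hence "(cmod (poly (trial s n w) (cis \<theta>)))\<^sup>2 \<le>
        (cmod (poly s w) * cmod (poly s (cis \<theta>)) * ((1 + r ^ n) / q))\<^sup>2"
      by (intro power_mono) auto
    hence "W \<theta> * (cmod (poly (trial s n w) (cis \<theta>)))\<^sup>2 \<le> 
        W \<theta> * (cmod (poly s w) * cmod (poly s (cis \<theta>)) * ((1 + r ^ n) / q))\<^sup>2"
      using W by (intro mult_left_mono) auto
    also have "\<dots> = c * ((cmod (poly s (cis \<theta>)))\<^sup>2 * W \<theta>) / q\<^sup>2"
      by (simp add: c_def power_mult_distrib power_divide)
    also have "\<dots> \<le> c * (1 + h \<theta>) / q\<^sup>2"
      using c0 by (intro divide_right_mono mult_left_mono) (auto simp: h_def)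
    also have "\<dots> = c * (1 / q\<^sup>2 + h \<theta> / q\<^sup>2)" by (simp add: add_divide_distrib distrib_left)
    also have "\<dots> \<le> c * (1 / q\<^sup>2 + h \<theta> / (1 - r)\<^sup>2)"
      using qr r q0 c0 by (intro mult_left_mono add_left_mono frac_le power_mono) (auto simp: h_def)
    also have "1 / q\<^sup>2 = poisson_kernel w \<theta> / (1 - (cmod w)\<^sup>2)"
      using w2 by (simp add: poisson_kernel_def q)
    finally show ?thesis .
  qed
  have cont: "continuous_on (sphere 0 1) (\<lambda>x. (cmod (poly (trial s n w) x))\<^sup>2)"
    by (intro continuous_intros)
  have "(LINT \<theta>|arc_measure. W \<theta> * (cmod (poly (trial s n w) (cis \<theta>)))\<^sup>2) \<le>
        (LINT \<theta>|arc_measure. c * (poisson_kernel w \<theta> / (1 - (cmod w)\<^sup>2) + h \<theta> / (1 - r)\<^sup>2))"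
    using pt ip ih integral_\<mu>(2)[OF cont] by (intro integral_mono) auto
  also have "\<dots> = c * (2 * pi / (1 - (cmod w)\<^sup>2) + (LINT \<theta>|arc_measure. h \<theta>) / (1 - r)\<^sup>2)"
    using ip ih by (simp add: integral_poisson_kernel[OF w1])
  also have "\<dots> \<le> c * (2 * pi / (1 - (cmod w)\<^sup>2) + e / (1 - r)\<^sup>2)"
    using s c0 by (intro mult_left_mono add_left_mono divide_right_mono) (auto simp: h_def)
  finally have "(LINT x|\<mu>. (cmod (poly (trial s n w) x))\<^sup>2) \<le> c * (2 * pi / (1 - (cmod w)\<^sup>2) + e / (1 - r)\<^sup>2) / (2 * pi)"
    unfolding integral_\<mu>(1)[OF cont] by (rule divide_right_mono) auto
  also have "\<dots> = c * (1 / (1 - (cmod w)\<^sup>2) + e / (2 * pi * (1 - r)\<^sup>2))"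
    using w2 r by (simp add: add_divide_distrib distrib_left)
  finally show ?thesis by (simp add: c_def)
qed

text \<open>With \<open>s\<close> tending to \<open>1 / D\<close> and more and more terms of the geometric series, the trial polynomials
  converge to the kernel and the bound on their norms converges to the diagonal value of the kernel,
  uniformly on the compact bidisc; one term of the sequence far enough out does. The degree bound is
  uniform in \<open>w\<close> because \<open>K\<^sub>n\<close> with one \<open>n\<close> has to be compared with them for all \<open>w\<close>.\<close>
lemma kernel_trial_polys:
  assumes r: "0 < r" "r < 1" and d: "d > 0"
  obtains p N where "\<And>w. degree (p w) \<le> N"
    "\<And>z w. cmod z \<le> r \<Longrightarrow> cmod w \<le> r \<Longrightarrow> cmod (poly (p w) z - szego_kernel z w) \<le> d"
    "\<And>w. cmod w \<le> r \<Longrightarrow> (LINT x|\<mu>. (cmod (poly (p w) x))\<^sup>2) \<le> Re (szego_kernel w w) + d"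
proof -
  obtain s where S: "uniform_limit (cball 0 r) (\<lambda>n. poly (s n)) (\<lambda>z. 1 / D z) sequentially"
    and s: "\<And>n. (LINT \<theta>|arc_measure. max 0 ((cmod (poly (s n) (cis \<theta>)))\<^sup>2 * W \<theta> - 1)) \<le> 1 / (real n + 1)"
    by (rule inverse_D_poly_sequence[OF r(2)]) (rule that)
  obtain B where B: "B > 0" "\<And>z. cmod z \<le> r \<Longrightarrow> cmod (1 / D z) \<le> B"
    using inverse_D_bound[OF r(2)] by blast
  let ?X = "cball 0 r \<times> cball 0 r :: (complex \<times> complex) set"
  let ?Y = "cball 0 r :: complex set"
  have lim_n: "uniform_limit A (\<lambda>n _. x n) (\<lambda>_. x0) sequentially" if "x \<longlonglongrightarrow> x0"
    for A :: "'b set" and x :: "nat \<Rightarrow> 'c::metric_space" and x0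
    using that by (auto simp: uniform_limit_iff tendsto_iff elim!: eventually_mono)
  have e0: "(\<lambda>n. 1 / (real n + 1)) \<longlonglongrightarrow> 0" by real_asymp
  have rn: "(\<lambda>n. r ^ n) \<longlonglongrightarrow> 0" using r by (intro LIMSEQ_power_zero) auto
  have bS: "bounded ((\<lambda>z. 1 / D z) ` ?Y)" by (rule boundedI[of _ B]) (use B(2) in \<open>auto simp del: norm_divide\<close>)
  have Sz: "uniform_limit ?X (\<lambda>n x. poly (s n) (fst x)) (\<lambda>x. 1 / D (fst x)) sequentially"
    by (rule uniform_limit_compose'[OF S]) auto
  have Sw: "uniform_limit ?X (\<lambda>n x. cnj (poly (s n) (snd x))) (\<lambda>x. cnj (1 / D (snd x))) sequentially"
  proof -
    have "uniform_limit ?X (\<lambda>n x. poly (s n) (snd x)) (\<lambda>x. 1 / D (snd x)) sequentially"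
      by (rule uniform_limit_compose'[OF S]) auto
    thus ?thesis unfolding uniform_limit_iff dist_norm
      by (simp only: complex_cnj_diff[symmetric] complex_mod_cnj)
  qed
  have zw: "cmod (z * cnj w) \<le> r" if "cmod z \<le> r" "cmod w \<le> r" for z w
  proof -
    have "cmod z * cmod w \<le> r * 1" using that r by (intro mult_mono) auto
    thus ?thesis by (simp add: norm_mult)
  qed
  have Gp: "uniform_limit ?X (\<lambda>n x. 1 - (fst x * cnj (snd x)) ^ n) (\<lambda>x. 1 - 0) sequentially"
  proof (intro uniform_limit_intros uniform_limitI)
    fix e :: real assume "e > 0"
    from order_tendstoD(2)[OF rn this]
    show "\<forall>\<^sub>F n in sequentially. \<forall>x\<in>?X. dist ((fst x * cnj (snd x)) ^ n) 0 < e"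
    proof eventually_elim
      case (elim n)
      have "cmod ((z * cnj w) ^ n) < e" if "cmod z \<le> r" "cmod w \<le> r" for z w
      proof -
        have "cmod ((z * cnj w) ^ n) \<le> r ^ n"
          unfolding norm_power using zw[OF that] by (intro power_mono) auto
        thus ?thesis using elim by simp
      qed
      thus ?case by auto
    qed
  qed
  have low: "1 - r \<le> cmod (1 - z * cnj w)" if "cmod z \<le> r" "cmod w \<le> r" for z w
    using norm_triangle_ineq2[of 1 "z * cnj w"] zw[OF that] by simp
  have bG: "bounded ((\<lambda>x. 1 / (1 - fst x * cnj (snd x))) ` ?X)"
    unfolding bounded_iff
  proof (intro exI[of _ "1 / (1 - r)"] ballI)
    fix y assume "y \<in> (\<lambda>x. 1 / (1 - fst x * cnj (snd x))) ` ?X"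
    then obtain z w where y: "y = 1 / (1 - z * cnj w)" and "cmod z \<le> r" "cmod w \<le> r" by auto
    hence "1 - r \<le> cmod (1 - z * cnj w)" by (intro low)
    thus "cmod y \<le> 1 / (1 - r)" unfolding y norm_divide using r by (intro frac_le) auto
  qed
  have bSz: "bounded ((\<lambda>x. 1 / D (fst x)) ` ?X)" and bSw: "bounded ((\<lambda>x. cnj (1 / D (snd x))) ` ?X)"
  proof -
    show "bounded ((\<lambda>x. 1 / D (fst x)) ` ?X)"
      by (rule boundedI[of _ B]) (use B(2) in \<open>auto simp del: norm_divide\<close>)
    have "cmod (cnj (1 / D w)) \<le> B" if "cmod w \<le> r" for w
      using B(2)[OF that] by (simp only: complex_mod_cnj)
    thus "bounded ((\<lambda>x. cnj (1 / D (snd x))) ` ?X)"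
      by (intro boundedI[of _ B]) (auto simp del: complex_cnj_divide norm_divide)
  qed
  have U1: "uniform_limit ?X (\<lambda>n x. (1 - (fst x * cnj (snd x)) ^ n) * (1 / (1 - fst x * cnj (snd x))))
      (\<lambda>x. (1 - 0) * (1 / (1 - fst x * cnj (snd x)))) sequentially"
    by (rule uniform_lim_mult[OF Gp uniform_limit_const _ bG]) (auto intro!: boundedI[of _ 1])
  have U2: "uniform_limit ?X (\<lambda>n x. cnj (poly (s n) (snd x)) * poly (s n) (fst x))
      (\<lambda>x. cnj (1 / D (snd x)) * (1 / D (fst x))) sequentially"
    by (rule uniform_lim_mult[OF Sw Sz bSw bSz])
  have bU1: "bounded ((\<lambda>x. (1 - 0) * (1 / (1 - fst x * cnj (snd x)))) ` ?X)" using bG by simp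
  have bU2: "bounded ((\<lambda>x. cnj (1 / D (snd x)) * (1 / D (fst x))) ` ?X)"
    unfolding bounded_iff
  proof (intro exI[of _ "B * B"] ballI)
    fix y assume "y \<in> (\<lambda>x. cnj (1 / D (snd x)) * (1 / D (fst x))) ` ?X"
    then obtain z w where y: "y = cnj (1 / D w) * (1 / D z)" and "cmod z \<le> r" "cmod w \<le> r" by auto
    hence "cmod (1 / D w) * cmod (1 / D z) \<le> B * B" using B by (intro mult_mono) auto
    thus "cmod y \<le> B * B" unfolding y norm_mult complex_mod_cnj .
  qed
  have "\<forall>\<^sub>F n in sequentially. \<forall>x\<in>?X. dist (cnj (poly (s n) (snd x)) * poly (s n) (fst x) *
            ((1 - (fst x * cnj (snd x)) ^ n) * (1 / (1 - fst x * cnj (snd x)))))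
          (cnj (1 / D (snd x)) * (1 / D (fst x)) * ((1 - 0) * (1 / (1 - fst x * cnj (snd x))))) < d"
    using uniform_limitD[OF uniform_lim_mult[OF U2 U1 bU2 bU1] d] .
  hence ev1: "\<forall>\<^sub>F n in sequentially. \<forall>z w. cmod z \<le> r \<longrightarrow> cmod w \<le> r \<longrightarrow>
      cmod (poly (trial (s n) n w) z - szego_kernel z w) \<le> d"
  proof eventually_elim
    case (elim n)
    show ?case
    proof (intro allI impI)
      fix z w :: complex assume z: "cmod z \<le> r" and w: "cmod w \<le> r"
      hence ne: "z * cnj w \<noteq> 1" using low[OF z w] r by auto
      show "cmod (poly (trial (s n) n w) z - szego_kernel z w) \<le> d"
        using bspec[OF elim, of "(z, w)"] z w
        by (simp add: poly_trial[OF ne] szego_kernel_def dist_norm mult_ac)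
    qed
  qed
  define b where "b = (\<lambda>n w. (cmod (poly (s n) w))\<^sup>2 * ((1 + r ^ n)\<^sup>2 *
      (1 / (1 - (cmod w)\<^sup>2) + 1 / (real n + 1) / (2 * pi * (1 - r)\<^sup>2))))"
  have N1: "uniform_limit ?Y (\<lambda>n w. (cmod (poly (s n) w))\<^sup>2) (\<lambda>w. (cmod (1 / D w))\<^sup>2) sequentially"
  proof -
    have "bounded ((\<lambda>w. cmod (1 / D w)) ` ?Y)"
      by (rule boundedI[of _ B]) (use B(2) in \<open>auto simp del: norm_divide\<close>)
    thus ?thesis unfolding power2_eq_square
      using uniform_limit_norm[OF S] by (intro uniform_lim_mult) auto
  qed
  have y0: "(\<lambda>n. 1 / (real n + 1) / (2 * pi * (1 - r)\<^sup>2)) \<longlonglongrightarrow> 0"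
    using tendsto_divide[OF e0 tendsto_const, of "2 * pi * (1 - r)\<^sup>2"] r by simp
  have y1: "(\<lambda>n. (1 + r ^ n)\<^sup>2) \<longlonglongrightarrow> 1"
    using tendsto_power[OF tendsto_add[OF tendsto_const rn], of 1 2] by simp
  have lowd: "1 - r\<^sup>2 \<le> 1 - (cmod w)\<^sup>2" if "cmod w \<le> r" for w :: complex
    using that by (intro diff_left_mono power_mono) auto
  have r2: "1 - r\<^sup>2 > 0" using r by (simp add: abs_square_less_1)
  have bP: "bounded ((\<lambda>w. 1 / (1 - (cmod w)\<^sup>2)) ` ?Y)"
    unfolding bounded_iff
  proof (intro exI[of _ "1 / (1 - r\<^sup>2)"] ballI)
    fix y assume "y \<in> (\<lambda>w::complex. 1 / (1 - (cmod w)\<^sup>2)) ` ?Y"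
    then obtain w :: complex where y: "y = 1 / (1 - (cmod w)\<^sup>2)" and w: "cmod w \<le> r" by auto
    have "\<bar>1 - (cmod w)\<^sup>2\<bar> \<ge> 1 - r\<^sup>2" using lowd[OF w] by linarith
    thus "norm y \<le> 1 / (1 - r\<^sup>2)" unfolding y norm_divide using r2 by (intro frac_le) auto
  qed
  have N2: "uniform_limit ?Y (\<lambda>n w. 1 / (1 - (cmod w)\<^sup>2) + 1 / (real n + 1) / (2 * pi * (1 - r)\<^sup>2))
      (\<lambda>w. 1 / (1 - (cmod w)\<^sup>2) + 0) sequentially"
    by (intro uniform_limit_add uniform_limit_const lim_n y0)
  have N3: "uniform_limit ?Y (\<lambda>n w. (1 + r ^ n)\<^sup>2 * (1 / (1 - (cmod w)\<^sup>2) + 1 / (real n + 1) / (2 * pi * (1 - r)\<^sup>2)))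
      (\<lambda>w. 1 * (1 / (1 - (cmod w)\<^sup>2) + 0)) sequentially"
    using bP by (intro uniform_lim_mult[OF lim_n[OF y1] N2]) (auto intro!: boundedI[of _ 1])
  have bN1: "bounded ((\<lambda>w. (cmod (1 / D w))\<^sup>2) ` ?Y)"
    unfolding bounded_iff using B(2) by (intro exI[of _ "B\<^sup>2"]) (auto intro: power_mono simp del: norm_divide)
  have "uniform_limit ?Y b (\<lambda>w. (cmod (1 / D w))\<^sup>2 * (1 * (1 / (1 - (cmod w)\<^sup>2) + 0))) sequentially"
    unfolding b_def using bP by (intro uniform_lim_mult[OF N1 N3 bN1]) simp
  from uniform_limitD[OF this d]
  have ev2: "\<forall>\<^sub>F n in sequentially. \<forall>w. cmod w \<le> r \<longrightarrow>
      (LINT x|\<mu>. (cmod (poly (trial (s n) n w) x))\<^sup>2) \<le> Re (szego_kernel w w) + d"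
  proof eventually_elim
    case (elim n)
    show ?case
    proof (intro allI impI)
      fix w :: complex assume w: "cmod w \<le> r"
      have "dist (b n w) ((cmod (1 / D w))\<^sup>2 * (1 * (1 / (1 - (cmod w)\<^sup>2) + 0))) < d"
        using elim w by simp
      moreover have "(cmod (1 / D w))\<^sup>2 * (1 * (1 / (1 - (cmod w)\<^sup>2) + 0)) = Re (szego_kernel w w)"
        by (simp add: szego_kernel_diag norm_divide power_divide)
      ultimately have "b n w \<le> Re (szego_kernel w w) + d" by (simp add: dist_real_def abs_less_iff)
      thus "(LINT x|\<mu>. (cmod (poly (trial (s n) n w) x))\<^sup>2) \<le> Re (szego_kernel w w) + d"
        using norm_trial_le[OF r(2) w s[of n], of n] by (simp add: b_def mult.assoc)
    qed
  qed
  obtain n where "\<forall>z w. cmod z \<le> r \<longrightarrow> cmod w \<le> r \<longrightarrow> cmod (poly (trial (s n) n w) z - szego_kernel z w) \<le> d"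
    "\<forall>w. cmod w \<le> r \<longrightarrow> (LINT x|\<mu>. (cmod (poly (trial (s n) n w) x))\<^sup>2) \<le> Re (szego_kernel w w) + d"
    using eventually_happens[OF eventually_conj[OF ev1 ev2]] by auto
  thus thesis
    by (intro that[of "trial (s n) n" "degree (s n) + n"] degree_trial) blast+
qed

end

section \<open>Convergence of the kernels\<close>

lemma Cauchy_Schwarz_sum_complex:
  fixes a b :: "'i \<Rightarrow> complex"
  shows "(cmod (\<Sum>i\<in>I. a i * b i))\<^sup>2 \<le> (\<Sum>i\<in>I. (cmod (a i))\<^sup>2) * (\<Sum>i\<in>I. (cmod (b i))\<^sup>2)"
proof -
  have "cmod (\<Sum>i\<in>I. a i * b i) \<le> (\<Sum>i\<in>I. cmod (a i) * cmod (b i))"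
    using norm_sum[of "\<lambda>i. a i * b i" I] by (simp add: norm_mult)
  hence "(cmod (\<Sum>i\<in>I. a i * b i))\<^sup>2 \<le> (\<Sum>i\<in>I. cmod (a i) * cmod (b i))\<^sup>2"
    by (intro power_mono) auto
  also have "\<dots> \<le> (\<Sum>i\<in>I. (cmod (a i))\<^sup>2) * (\<Sum>i\<in>I. (cmod (b i))\<^sup>2)"
    by (rule Cauchy_Schwarz_ineq_sum)
  finally show ?thesis .
qed

locale szego_polys = szego_weight +
  fixes \<phi> :: "nat \<Rightarrow> complex poly"
  assumes orthonormal: "orthonormal_polys \<mu> \<phi>"
begin

lemma degree_\<phi>: "degree (\<phi> j) = j"
  and integral_\<phi>: "(LINT x|\<mu>. poly (\<phi> j) x * cnj (poly (\<phi> k) x)) = (if j = k then 1 else 0)"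
  using orthonormal unfolding orthonormal_polys_def by auto

lemma lead_coeff_\<phi>: "coeff (\<phi> j) j \<noteq> 0"
proof -
  obtain c :: real where "c > 0" "lead_coeff (\<phi> j) = complex_of_real c"
    using orthonormal unfolding orthonormal_polys_def by blast
  thus ?thesis using degree_\<phi>[of j] by simp
qed

lemma \<phi>_spans:
  assumes "degree p \<le> n"
  shows "\<exists>a. p = (\<Sum>j=0..n. smult (a j) (\<phi> j))"
  using assms
proof (induction n arbitrary: p)
  case 0
  obtain c where c: "p = [:c:]" using 0 by (auto elim: degree_eq_zeroE)
  obtain d where d: "\<phi> 0 = [:d:]" by (rule degree_eq_zeroE[OF degree_\<phi>[of 0]])
  have "d \<noteq> 0" using lead_coeff_\<phi>[of 0] d by simp
  thus ?case by (intro exI[of _ "\<lambda>_. c / d"]) (simp add: c d)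
next
  case (Suc n)
  define c where "c = coeff p (Suc n) / coeff (\<phi> (Suc n)) (Suc n)"
  have "degree (p - smult c (\<phi> (Suc n))) \<le> n"
  proof (rule degree_le, intro allI impI)
    fix i assume "n < i"
    show "coeff (p - smult c (\<phi> (Suc n))) i = 0"
    proof (cases "i = Suc n")
      case True
      thus ?thesis using lead_coeff_\<phi>[of "Suc n"] by (simp add: c_def)
    next
      case False
      hence "i > degree p" "i > degree (\<phi> (Suc n))" using \<open>n < i\<close> Suc(2) degree_\<phi>[of "Suc n"] by auto
      thus ?thesis by (simp add: coeff_eq_0)
    qed
  qed
  then obtain a where a: "p - smult c (\<phi> (Suc n)) = (\<Sum>j=0..n. smult (a j) (\<phi> j))"
    using Suc.IH by blast
  have "(\<Sum>j=0..Suc n. smult ((a(Suc n := c)) j) (\<phi> j)) = (\<Sum>j=0..n. smult (a j) (\<phi> j)) + smult c (\<phi> (Suc n))"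
  proof -
    have "(\<Sum>j=0..n. smult ((a(Suc n := c)) j) (\<phi> j)) = (\<Sum>j=0..n. smult (a j) (\<phi> j))"
      by (intro sum.cong) auto
    thus ?thesis by (simp del: fun_upd_apply) simp
  qed
  also have "\<dots> = p" by (simp flip: a)
  finally have "p = (\<Sum>j=0..Suc n. smult ((a(Suc n := c)) j) (\<phi> j))" by (rule sym)
  thus ?case by (rule exI[where P = "\<lambda>a. p = (\<Sum>j=0..Suc n. smult (a j) (\<phi> j))"])
qed

lemma parseval:
  "(LINT x|\<mu>. (cmod (poly (\<Sum>j=0..n. smult (a j) (\<phi> j)) x))\<^sup>2) = (\<Sum>j=0..n. (cmod (a j))\<^sup>2)"
proof -
  have int: "integrable \<mu> (\<lambda>x. c * (poly (\<phi> j) x * cnj (poly (\<phi> k) x)))" for j k c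
    by (intro continuous_integrable_\<mu> continuous_intros)
  have "complex_of_real (LINT x|\<mu>. (cmod (poly (\<Sum>j=0..n. smult (a j) (\<phi> j)) x))\<^sup>2) =
        (LINT x|\<mu>. (\<Sum>j=0..n. \<Sum>k=0..n. a j * cnj (a k) * (poly (\<phi> j) x * cnj (poly (\<phi> k) x))))"
    unfolding integral_complex_of_real[symmetric]
    by (intro Bochner_Integration.integral_cong refl)
       (simp add: complex_norm_square poly_sum sum_product mult_ac del: of_real_power)
  also have "\<dots> = (\<Sum>j=0..n. \<Sum>k=0..n. a j * cnj (a k) * (LINT x|\<mu>. poly (\<phi> j) x * cnj (poly (\<phi> k) x)))"
    using int by (simp add: Bochner_Integration.integral_sum Bochner_Integration.integrable_sum)
  also have "\<dots> = (\<Sum>j=0..n. \<Sum>k=0..n. if j = k then a j * cnj (a k) else 0)"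
    by (intro sum.cong refl) (simp add: integral_\<phi>)
  also have "\<dots> = (\<Sum>j=0..n. a j * cnj (a j))" by simp
  also have "\<dots> = complex_of_real (\<Sum>j=0..n. (cmod (a j))\<^sup>2)"
    by (simp add: complex_norm_square del: of_real_power)
  finally show ?thesis by (simp only: of_real_eq_iff)
qed

lemma kernel_eq: "kernel \<phi> n z w = (\<Sum>j=0..n. poly (\<phi> j) z * cnj (poly (\<phi> j) w))"
  by (simp add: kernel_deriv_def)

lemma kernel_diag: "kernel \<phi> n z z = complex_of_real (\<Sum>j=0..n. (cmod (poly (\<phi> j) z))\<^sup>2)"
  by (simp add: kernel_eq complex_norm_square del: of_real_power)

text \<open>The upper bound applied to the polynomial \<open>k = K\<^sub>n(\<cdot>, z)\<close>, whose squared norm and whose value at \<open>z\<close>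
  are both \<open>K\<^sub>n(z, z)\<close>.\<close>
lemma kernel_diag_le:
  assumes z: "cmod z < 1"
  shows "Re (kernel \<phi> n z z) \<le> Re (szego_kernel z z)"
proof -
  define \<kappa> where "\<kappa> = (\<Sum>j=0..n. (cmod (poly (\<phi> j) z))\<^sup>2)"
  define k where "k = (\<Sum>j=0..n. smult (cnj (poly (\<phi> j) z)) (\<phi> j))"
  have k: "poly k z = complex_of_real \<kappa>"
    using kernel_diag[of n z] by (simp add: kernel_eq k_def poly_sum \<kappa>_def mult.commute)
  have "(LINT x|\<mu>. (cmod (poly k x))\<^sup>2) = \<kappa>"
    unfolding k_def parseval by (simp add: \<kappa>_def)
  hence "(1 - (cmod z)\<^sup>2) * (cmod (complex_of_real \<kappa> * D z))\<^sup>2 \<le> \<kappa>"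
    using polynomial_bound[OF z, of k] k by simp
  hence 1: "\<kappa> * (\<kappa> * ((1 - (cmod z)\<^sup>2) * (cmod (D z))\<^sup>2)) \<le> \<kappa> * 1"
    by (simp add: norm_mult power_mult_distrib power2_eq_square mult_ac)
  have pos: "(1 - (cmod z)\<^sup>2) * (cmod (D z))\<^sup>2 > 0"
    using z by (simp add: abs_square_less_1)
  have "\<kappa> \<ge> 0" unfolding \<kappa>_def by (intro sum_nonneg) auto
  hence "\<kappa> \<le> 1 / ((1 - (cmod z)\<^sup>2) * (cmod (D z))\<^sup>2)"
  proof (cases "\<kappa> = 0")
    case True
    thus ?thesis using pos by simp
  next
    case False
    hence "\<kappa> * ((1 - (cmod z)\<^sup>2) * (cmod (D z))\<^sup>2) \<le> 1"
      using 1 \<open>\<kappa> \<ge> 0\<close> by (simp only: mult_le_cancel_left)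
    thus ?thesis using pos by (simp add: pos_le_divide_eq)
  qed
  thus ?thesis unfolding kernel_diag szego_kernel_diag by (simp add: \<kappa>_def)
qed

text \<open>The first factor on the right is the squared norm of \<open>p - K\<^sub>n(\<cdot>, w)\<close>, computed in the
  orthonormal basis, and the second factor is the squared norm of evaluation at \<open>z\<close>.\<close>
lemma poly_minus_kernel:
  assumes "degree p \<le> n"
  shows "(cmod (poly p z - kernel \<phi> n z w))\<^sup>2 \<le>
    ((LINT x|\<mu>. (cmod (poly p x))\<^sup>2) - 2 * Re (poly p w) + Re (kernel \<phi> n w w)) * Re (kernel \<phi> n z z)"
proof -
  obtain a where p: "p = (\<Sum>j=0..n. smult (a j) (\<phi> j))" using \<phi>_spans[OF assms] by blast
  have pz: "poly p x = (\<Sum>j=0..n. a j * poly (\<phi> j) x)" for x by (simp add: p poly_sum)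
  have "poly p z - kernel \<phi> n z w = (\<Sum>j=0..n. (a j - cnj (poly (\<phi> j) w)) * poly (\<phi> j) z)"
    by (simp add: pz kernel_eq algebra_simps sum_subtractf)
  hence le: "(cmod (poly p z - kernel \<phi> n z w))\<^sup>2 \<le>
      (\<Sum>j=0..n. (cmod (a j - cnj (poly (\<phi> j) w)))\<^sup>2) * Re (kernel \<phi> n z z)"
    by (simp only: Cauchy_Schwarz_sum_complex kernel_diag Re_complex_of_real)
  have "(\<Sum>j=0..n. (cmod (a j - cnj (poly (\<phi> j) w)))\<^sup>2) =
      (\<Sum>j=0..n. (cmod (a j))\<^sup>2 - 2 * Re (a j * poly (\<phi> j) w) + (cmod (poly (\<phi> j) w))\<^sup>2)"
    by (intro sum.cong refl) (simp only: cmod_power2, simp add: algebra_simps power2_eq_square)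
  also have "\<dots> = (\<Sum>j=0..n. (cmod (a j))\<^sup>2) - 2 * (\<Sum>j=0..n. Re (a j * poly (\<phi> j) w)) +
      (\<Sum>j=0..n. (cmod (poly (\<phi> j) w))\<^sup>2)"
    unfolding sum.distrib sum_subtractf sum_distrib_left ..
  also have "(\<Sum>j=0..n. (cmod (a j))\<^sup>2) = (LINT x|\<mu>. (cmod (poly p x))\<^sup>2)"
    unfolding p by (rule parseval[symmetric])
  also have "(\<Sum>j=0..n. Re (a j * poly (\<phi> j) w)) = Re (poly p w)" unfolding pz Re_sum ..
  also have "(\<Sum>j=0..n. (cmod (poly (\<phi> j) w))\<^sup>2) = Re (kernel \<phi> n w w)"
    unfolding kernel_diag Re_complex_of_real ..
  finally show ?thesis using le by (simp only:)
qed

text \<open>For a trial polynomial \<open>p\<close> with error \<open>d\<close> the squared distance to \<open>K\<^sub>n(\<cdot>, w)\<close> is at most \<open>3 * d\<close>: its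
  squared norm exceeds \<open>K(w, w)\<close> by at most \<open>d\<close>, twice the value at \<open>w\<close> falls short by at most \<open>2 * d\<close>, and
  \<open>K\<^sub>n(w, w) \<le> K(w, w)\<close>.\<close>
lemma kernel_tendsto_szego_kernel: "bidisc_limit (\<lambda>n. kernel \<phi> n) szego_kernel"
  unfolding bidisc_limit_iff
proof (intro allI impI)
  fix r0 e :: real assume "r0 < 1" and e: "e > 0"
  \<comment> \<open>The given radius may be nonpositive.\<close>
  define r where "r = max r0 (1 / 2)"
  have r: "0 < r" "r < 1" "r0 \<le> r" using \<open>r0 < 1\<close> by (auto simp: r_def)
  obtain B where B: "B > 0" "\<And>z. cmod z \<le> r \<Longrightarrow> cmod (1 / D z) \<le> B"
    by (rule inverse_D_bound[OF r(2)]) (rule that)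
  define C where "C = B\<^sup>2 / (1 - r\<^sup>2)"
  have r2: "1 - r\<^sup>2 > 0" using r by (simp add: abs_square_less_1)
  have C0: "C > 0" using B(1) r2 by (simp add: C_def)
  have C: "Re (szego_kernel z z) \<le> C" if "cmod z \<le> r" for z
  proof -
    have "(cmod z)\<^sup>2 \<le> r\<^sup>2" using that by (intro power_mono) auto
    moreover have "(cmod (1 / D z))\<^sup>2 \<le> B\<^sup>2" using B(2)[OF that] by (intro power_mono) auto
    ultimately have "(cmod (1 / D z))\<^sup>2 / (1 - (cmod z)\<^sup>2) \<le> C"
      unfolding C_def using r2 by (intro frac_le) auto
    thus ?thesis by (simp add: szego_kernel_diag norm_divide power_divide mult.commute)
  qed
  \<comment> \<open>Then \<open>sqrt (3 * d * C) \<le> e / 3\<close>, and the two errors add up to less than \<open>e\<close>.\<close>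
  define d where "d = min (e / 3) (e\<^sup>2 / (27 * C))"
  have d: "d > 0" "d \<le> e / 3" "3 * d * C \<le> (e / 3)\<^sup>2"
  proof -
    show "d > 0" "d \<le> e / 3" using e C0 by (auto simp: d_def)
    have "d * (3 * C) \<le> e\<^sup>2 / (27 * C) * (3 * C)" using C0 by (intro mult_right_mono) (auto simp: d_def)
    also have "\<dots> = (e / 3)\<^sup>2" using C0 by (simp add: power2_eq_square)
    finally show "3 * d * C \<le> (e / 3)\<^sup>2" by (simp add: mult_ac)
  qed
  show "\<forall>\<^sub>F n in sequentially. \<forall>z w. cmod z \<le> r0 \<longrightarrow> cmod w \<le> r0 \<longrightarrow> cmod (kernel \<phi> n z w - szego_kernel z w) < e"
  proof (rule kernel_trial_polys[OF r(1,2) d(1)])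
    fix p :: "complex \<Rightarrow> complex poly" and N
    assume p: "\<And>w. degree (p w) \<le> N"
      "\<And>z w. cmod z \<le> r \<Longrightarrow> cmod w \<le> r \<Longrightarrow> cmod (poly (p w) z - szego_kernel z w) \<le> d"
      "\<And>w. cmod w \<le> r \<Longrightarrow> (LINT x|\<mu>. (cmod (poly (p w) x))\<^sup>2) \<le> Re (szego_kernel w w) + d"
    show "\<forall>\<^sub>F n in sequentially. \<forall>z w. cmod z \<le> r0 \<longrightarrow> cmod w \<le> r0 \<longrightarrow> cmod (kernel \<phi> n z w - szego_kernel z w) < e"
    proof (intro eventually_sequentiallyI[of N] allI impI)
      fix n z w assume n: "N \<le> n" and "cmod z \<le> r0" "cmod w \<le> r0"
      hence z: "cmod z \<le> r" and w: "cmod w \<le> r" using r(3) by auto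
      have "Re (szego_kernel w w) - d \<le> Re (poly (p w) w)"
        using p(2)[OF w w] abs_Re_le_cmod[of "poly (p w) w - szego_kernel w w"] by simp
      moreover have "Re (kernel \<phi> n w w) \<le> Re (szego_kernel w w)" using w r(2) by (intro kernel_diag_le) simp
      ultimately have gap: "(LINT x|\<mu>. (cmod (poly (p w) x))\<^sup>2) - 2 * Re (poly (p w) w) + Re (kernel \<phi> n w w) \<le> 3 * d"
        using p(3)[OF w] by linarith
      have "Re (kernel \<phi> n z z) \<le> Re (szego_kernel z z)" using z r(2) by (intro kernel_diag_le) simp
      hence kz: "Re (kernel \<phi> n z z) \<le> C" using C[OF z] by linarith
      have kz0: "0 \<le> Re (kernel \<phi> n z z)" unfolding kernel_diag by (simp add: sum_nonneg)
      have "(cmod (poly (p w) z - kernel \<phi> n z w))\<^sup>2 \<le>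
        ((LINT x|\<mu>. (cmod (poly (p w) x))\<^sup>2) - 2 * Re (poly (p w) w) + Re (kernel \<phi> n w w)) * Re (kernel \<phi> n z z)"
        using p(1)[of w] n by (intro poly_minus_kernel) simp
      also have "\<dots> \<le> 3 * d * C" by (rule mult_mono[OF gap kz _ kz0]) (use d(1) in simp)
      also have "\<dots> \<le> (e / 3)\<^sup>2" by (rule d(3))
      finally have "cmod (poly (p w) z - kernel \<phi> n z w) \<le> e / 3"
        by (rule power2_le_imp_le) (use e in simp)
      moreover have "cmod (poly (p w) z - szego_kernel z w) \<le> e / 3"
        using p(2)[OF z w] d(2) by linarith
      moreover have "cmod (kernel \<phi> n z w - szego_kernel z w) \<le>
          cmod (poly (p w) z - szego_kernel z w) + cmod (poly (p w) z - kernel \<phi> n z w)"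
        using norm_triangle_ineq4[of "poly (p w) z - szego_kernel z w" "poly (p w) z - kernel \<phi> n z w"] by simp
      ultimately show "cmod (kernel \<phi> n z w - szego_kernel z w) < e" using e by linarith
    qed
  qed
qed

end

section \<open>Derivatives of the kernels and the density\<close>

lemma bidisc_limit_diag:
  assumes "bidisc_limit f g" "r < 1"
  shows "uniform_limit (cball 0 r) (\<lambda>n z. f n z z) (\<lambda>z. g z z) sequentially"
  unfolding uniform_limit_iff
proof (intro allI impI)
  fix e :: real assume "e > 0"
  with assms have "\<forall>\<^sub>F n in sequentially. \<forall>z w. cmod z \<le> r \<longrightarrow> cmod w \<le> r \<longrightarrow> cmod (f n z w - g z w) < e"
    unfolding bidisc_limit_iff by blast
  thus "\<forall>\<^sub>F n in sequentially. \<forall>z\<in>cball 0 r. dist (f n z z) (g z z) < e"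
    by (rule eventually_mono) (simp add: dist_norm)
qed

lemma bidisc_limit_cong:
  assumes "bidisc_limit f g" "\<And>n z w. f n z w = f' n z w"
    and "\<And>z w. z \<in> ball 0 1 \<Longrightarrow> w \<in> ball 0 1 \<Longrightarrow> g z w = g' z w"
  shows "bidisc_limit f' g'"
  unfolding bidisc_limit_iff
proof (intro allI impI)
  fix r e :: real assume "r < 1" "e > 0"
  hence "\<forall>\<^sub>F n in sequentially. \<forall>z w. cmod z \<le> r \<longrightarrow> cmod w \<le> r \<longrightarrow> cmod (f n z w - g z w) < e"
    using assms(1) unfolding bidisc_limit_iff by blast
  thus "\<forall>\<^sub>F n in sequentially. \<forall>z w. cmod z \<le> r \<longrightarrow> cmod w \<le> r \<longrightarrow> cmod (f' n z w - g' z w) < e"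
  proof (rule eventually_mono, intro allI impI)
    fix n z w
    assume *: "\<forall>z w. cmod z \<le> r \<longrightarrow> cmod w \<le> r \<longrightarrow> cmod (f n z w - g z w) < e"
      and z: "cmod z \<le> r" and w: "cmod w \<le> r"
    have "g z w = g' z w" using z w \<open>r < 1\<close> by (intro assms(3)) auto
    moreover have "cmod (f n z w - g z w) < e" using * z w by blast
    ultimately show "cmod (f' n z w - g' z w) < e" by (simp only: assms(2))
  qed
qed

lemma uniform_limit_Pair:
  assumes "uniform_limit X f f' F" "uniform_limit X g g' F"
  shows "uniform_limit X (\<lambda>n x. (f n x, g n x)) (\<lambda>x. (f' x, g' x)) F"
proof (rule uniform_limitI)
  fix e :: real assume "e > 0"
  hence "\<forall>\<^sub>F n in F. \<forall>x\<in>X. dist (f n x) (f' x) < e / 2" "\<forall>\<^sub>F n in F. \<forall>x\<in>X. dist (g n x) (g' x) < e / 2"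
    using uniform_limitD[OF assms(1), of "e / 2"] uniform_limitD[OF assms(2), of "e / 2"] by simp_all
  thus "\<forall>\<^sub>F n in F. \<forall>x\<in>X. dist (f n x, g n x) (f' x, g' x) < e"
  proof eventually_elim
    case (elim n)
    show ?case
    proof
      fix x assume "x \<in> X"
      have "dist (f n x, g n x) (f' x, g' x) \<le> dist (f n x) (f' x) + dist (g n x) (g' x)"
        unfolding dist_Pair_Pair by (rule sqrt_sum_squares_le_sum) auto
      also have "\<dots> < e / 2 + e / 2" using elim \<open>x \<in> X\<close> by (intro add_strict_mono) auto
      finally show "dist (f n x, g n x) (f' x, g' x) < e" by simp
    qed
  qed
qed

text \<open>Continuity of the outer function suffices because the functions eventually take their values in one
  compact set.\<close>
lemma uniform_limit_compose_continuous:
  fixes f :: "'n \<Rightarrow> 'a \<Rightarrow> 'b::euclidean_space" and h :: "'b \<Rightarrow> 'c::metric_space"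
  assumes lim: "uniform_limit X f g F" and bd: "bounded (g ` X)"
    and U: "closed U" "continuous_on U h" "\<And>n x. x \<in> X \<Longrightarrow> f n x \<in> U"
  shows "uniform_limit X (\<lambda>n x. h (f n x)) (\<lambda>x. h (g x)) F"
proof -
  obtain B where B: "\<And>x. x \<in> X \<Longrightarrow> norm (g x) \<le> B" using bd unfolding bounded_iff by auto
  have comp: "compact (U \<inter> cball 0 (B + 1))" using U(1) by (intro closed_Int_compact) auto
  show ?thesis
  proof (rule uniform_limit_compose_uniformly_continuous_on[OF lim])
    show "uniformly_continuous_on (U \<inter> cball 0 (B + 1)) h"
      using comp by (intro compact_uniformly_continuous continuous_on_subset[OF U(2)]) auto
    have "\<forall>\<^sub>F n in F. \<forall>x\<in>X. dist (f n x) (g x) < 1" using lim by (rule uniform_limitD) simp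
    thus "\<forall>\<^sub>F n in F. \<forall>x\<in>X. f n x \<in> U \<inter> cball 0 (B + 1)"
    proof (rule eventually_mono, intro ballI)
      fix n x assume "\<forall>x\<in>X. dist (f n x) (g x) < 1" "x \<in> X"
      hence "norm (f n x - g x) < 1" "norm (g x) \<le> B" using B by (auto simp: dist_norm)
      hence "norm (f n x) \<le> B + 1" using norm_triangle_ineq2[of "f n x" "g x"] by linarith
      thus "f n x \<in> U \<inter> cball 0 (B + 1)" using U(3) \<open>x \<in> X\<close> by simp
    qed
    show "closed (U \<inter> cball 0 (B + 1))" using U(1) by auto
  qed
qed

lemma DERIV_kernel_deriv:
  "((\<lambda>z. kernel_deriv \<phi> k l n z w) has_field_derivative kernel_deriv \<phi> (Suc k) l n z w) (at z)"
  unfolding kernel_deriv_def by (auto intro!: DERIV_sum DERIV_cmult_right poly_DERIV)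

lemma kernel_deriv_holomorphic: "(\<lambda>z. kernel_deriv \<phi> k l n z w) holomorphic_on A"
  unfolding holomorphic_on_def field_differentiable_def
  by (intro ballI exI) (rule has_field_derivative_at_within[OF DERIV_kernel_deriv])

lemma kernel_deriv_cnj_swap: "cnj (kernel_deriv \<phi> k l n w z) = kernel_deriv \<phi> l k n z w"
  by (simp add: kernel_deriv_def mult.commute)

context szego_weight
begin

abbreviation S :: "complex \<Rightarrow> complex" where "S z \<equiv> 1 / D z"

lemma DERIV_S: "z \<in> ball 0 1 \<Longrightarrow> (S has_field_derivative deriv S z) (at z)"
  using inverse_D_holomorphic by (rule holomorphic_derivI) auto

lemma deriv_S:
  assumes z: "z \<in> ball 0 1"
  shows "deriv S z = - (deriv D z / D z) * S z"
proof -
  have "((\<lambda>z. inverse (S z)) has_field_derivative - (inverse (S z) * deriv S z * inverse (S z))) (at z)"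
    by (rule DERIV_inverse'[OF DERIV_S[OF z]]) simp
  hence "(D has_field_derivative - (inverse (S z) * deriv S z * inverse (S z))) (at z)" by simp
  hence "deriv D z = - (inverse (S z) * deriv S z * inverse (S z))" by (rule DERIV_imp_deriv)
  thus ?thesis by (simp add: field_simps)
qed

text \<open>The derivative of the limit kernel in its first variable; below, \<open>01\<close> stands for the derivative in
  the conjugate of the second variable and \<open>11\<close> for the mixed one.\<close>
definition szego_kernel_10 :: "complex \<Rightarrow> complex \<Rightarrow> complex" where
  "szego_kernel_10 z w = cnj (S w) * (deriv S z / (1 - z * cnj w) + S z * cnj w / (1 - z * cnj w)\<^sup>2)"

definition szego_kernel_01 :: "complex \<Rightarrow> complex \<Rightarrow> complex" where
  "szego_kernel_01 z w = S z * (cnj (deriv S w) / (1 - z * cnj w) + cnj (S w) * z / (1 - z * cnj w)\<^sup>2)"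

definition szego_kernel_11 :: "complex \<Rightarrow> complex \<Rightarrow> complex" where
  "szego_kernel_11 z w =
     deriv S z * (cnj (deriv S w) / (1 - z * cnj w) + cnj (S w) * z / (1 - z * cnj w)\<^sup>2) +
     S z * (cnj (deriv S w) * cnj w / (1 - z * cnj w)\<^sup>2 + cnj (S w) / (1 - z * cnj w)\<^sup>2 +
            2 * cnj (S w) * z * cnj w / (1 - z * cnj w) ^ 3)"

lemma DERIV_szego_kernel:
  assumes z: "z \<in> ball 0 1" and w: "w \<in> ball 0 1"
  shows "((\<lambda>z. szego_kernel z w) has_field_derivative szego_kernel_10 z w) (at z)"
    and "((\<lambda>z. szego_kernel_01 z w) has_field_derivative szego_kernel_11 z w) (at z)"
proof -
  have nz: "1 - z * cnj w \<noteq> 0" using one_minus_mult_nz[of z "cnj w"] z w by simp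
  have lin: "((\<lambda>z. 1 - z * cnj w) has_field_derivative - cnj w) (at z)"
    by (auto intro!: derivative_eq_intros)
  have inv: "((\<lambda>z. c / (1 - z * cnj w)) has_field_derivative c * cnj w / (1 - z * cnj w)\<^sup>2) (at z)" for c
    using DERIV_cmult[OF DERIV_inverse'[OF lin nz], of c] by (simp add: divide_inverse power2_eq_square mult_ac)
  have inv2: "((\<lambda>z. c * z / (1 - z * cnj w)\<^sup>2) has_field_derivative
      c / (1 - z * cnj w)\<^sup>2 + 2 * c * z * cnj w / (1 - z * cnj w) ^ 3) (at z)" for c
  proof -
    have "((\<lambda>z. c * z / (1 - z * cnj w)\<^sup>2) has_field_derivative
        (c * (1 - z * cnj w)\<^sup>2 - c * z * (2 * (1 - z * cnj w) * (- cnj w))) / ((1 - z * cnj w)\<^sup>2 * (1 - z * cnj w)\<^sup>2)) (at z)"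
      using nz by (auto intro!: derivative_eq_intros)
    also have "(c * (1 - z * cnj w)\<^sup>2 - c * z * (2 * (1 - z * cnj w) * (- cnj w))) / ((1 - z * cnj w)\<^sup>2 * (1 - z * cnj w)\<^sup>2)
        = c / (1 - z * cnj w)\<^sup>2 + 2 * c * z * cnj w / (1 - z * cnj w) ^ 3"
    proof -
      have "(c * P\<^sup>2 - c * z * (2 * P * (- y))) / (P\<^sup>2 * P\<^sup>2) = c / P\<^sup>2 + 2 * c * z * y / P ^ 3"
        if "P \<noteq> 0" for P y :: complex
        using that by (simp add: divide_simps power2_eq_square power3_eq_cube) (simp add: algebra_simps)
      thus ?thesis using nz by blast
    qed
    finally show ?thesis .
  qed
  have "((\<lambda>z. S z * (cnj (S w) / (1 - z * cnj w))) has_field_derivative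
      deriv S z * (cnj (S w) / (1 - z * cnj w)) + (cnj (S w) * cnj w / (1 - z * cnj w)\<^sup>2) * S z) (at z)"
    by (rule DERIV_mult[OF DERIV_S[OF z] inv])
  thus "((\<lambda>z. szego_kernel z w) has_field_derivative szego_kernel_10 z w) (at z)"
    by (simp add: szego_kernel_def szego_kernel_10_def algebra_simps)
  have "((\<lambda>z. S z * (cnj (deriv S w) / (1 - z * cnj w) + cnj (S w) * z / (1 - z * cnj w)\<^sup>2)) has_field_derivative
      deriv S z * (cnj (deriv S w) / (1 - z * cnj w) + cnj (S w) * z / (1 - z * cnj w)\<^sup>2) +
      (cnj (deriv S w) * cnj w / (1 - z * cnj w)\<^sup>2 +
        (cnj (S w) / (1 - z * cnj w)\<^sup>2 + 2 * cnj (S w) * z * cnj w / (1 - z * cnj w) ^ 3)) * S z) (at z)"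
    by (rule DERIV_mult[OF DERIV_S[OF z] DERIV_add[OF inv inv2]])
  thus "((\<lambda>z. szego_kernel_01 z w) has_field_derivative szego_kernel_11 z w) (at z)"
    unfolding szego_kernel_01_def szego_kernel_11_def by (simp only: mult.commute[of _ "S z"] add.assoc)
qed

text \<open>Here \<open>\<beta>\<close> is the derivative of \<open>log K(z, w)\<close> in the conjugate of \<open>w\<close> on the diagonal, and \<open>1 / p\<^sup>2\<close> is the
  mixed derivative of \<open>log K\<close>. The proof writes \<open>a\<close> for the logarithmic derivative of \<open>1 / D\<close>.\<close>
lemma szego_kernel_diag_values:
  fixes z
  assumes z: "z \<in> ball 0 1"
  defines "p \<equiv> 1 - (cmod z)\<^sup>2"
  defines "\<beta> \<equiv> z / complex_of_real p - cnj (deriv D z) / cnj (D z)"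
  shows "szego_kernel_01 z z = szego_kernel z z * \<beta>"
    and "szego_kernel_11 z z = szego_kernel z z * complex_of_real ((cmod \<beta>)\<^sup>2 + 1 / p\<^sup>2)"
proof -
  have "p > 0" using z by (simp add: p_def abs_square_less_1)
  hence P: "complex_of_real p \<noteq> 0" by simp
  have zz: "z * cnj z = 1 - complex_of_real p" using complex_norm_square[of z] by (simp add: p_def)
  hence zp: "1 - z * cnj z = complex_of_real p" by simp
  define a where "a = - (deriv D z / D z)"
  have S': "deriv S z = a * S z" using deriv_S[OF z] by (simp add: a_def)
  have S'c: "cnj (deriv S z) = cnj a * cnj (S z)" unfolding S' by (rule complex_cnj_mult)
  have \<beta>: "\<beta> = z / complex_of_real p + cnj a" by (simp add: \<beta>_def a_def)
  have \<beta>c: "cnj \<beta> = cnj z / complex_of_real p + a" by (simp add: \<beta>)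
  have K: "szego_kernel z z = S z * cnj (S z) / complex_of_real p"
    by (simp only: szego_kernel_def zp)
  show "szego_kernel_01 z z = szego_kernel z z * \<beta>"
  proof -
    have "s * (b * t / P + t * z / P\<^sup>2) = s * t / P * (z / P + b)" if "P \<noteq> 0" for s t b P :: complex
      using that by (simp add: field_simps power2_eq_square)
    thus ?thesis unfolding K \<beta> szego_kernel_01_def zp S'c using P by blast
  qed
  have "szego_kernel_11 z z = szego_kernel z z * (\<beta> * cnj \<beta> + 1 / (complex_of_real p)\<^sup>2)"
  proof -
    have "(a * s) * (b * t / P + t * z / P\<^sup>2) + s * (b * t * y / P\<^sup>2 + t / P\<^sup>2 + 2 * t * z * y / P ^ 3) =
        s * t / P * ((z / P + b) * (y / P + a) + 1 / P\<^sup>2)" if "P \<noteq> 0" "z * y = 1 - P" for s t b y P :: complex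
    proof -
      have "2 * t * z * y = 2 * t * (1 - P)" using that(2) by (simp add: mult.assoc)
      moreover have "(z / P + b) * (y / P + a) = (1 - P) / P\<^sup>2 + z * a / P + b * y / P + b * a"
        using that by (simp add: power2_eq_square algebra_simps flip: that(2)) 
      ultimately show ?thesis
        using that(1) by (simp add: divide_simps power2_eq_square power3_eq_cube) (use that(2) in algebra)
    qed
    thus ?thesis unfolding K \<beta>c unfolding \<beta> szego_kernel_11_def zp S'c unfolding S' using P zz by blast
  qed
  also have "\<beta> * cnj \<beta> + 1 / (complex_of_real p)\<^sup>2 = complex_of_real ((cmod \<beta>)\<^sup>2 + 1 / p\<^sup>2)"
    using complex_norm_square[of \<beta>] by simp
  finally show "szego_kernel_11 z z = szego_kernel z z * complex_of_real ((cmod \<beta>)\<^sup>2 + 1 / p\<^sup>2)" .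
qed

end

context szego_polys
begin

lemma kernel_derivs_tendsto:
  shows "bidisc_limit (kernel_deriv \<phi> 0 1) szego_kernel_01"
    and "bidisc_limit (kernel_deriv \<phi> 1 1) szego_kernel_11"
proof -
  have "bidisc_limit (\<lambda>n z w. deriv (\<lambda>z. kernel \<phi> n z w) z) (\<lambda>z w. deriv (\<lambda>z. szego_kernel z w) z)"
    using kernel_tendsto_szego_kernel
  proof (rule bidisc_limit_deriv)
    show "(\<lambda>z. szego_kernel z w) holomorphic_on ball 0 1" if "w \<in> ball 0 1" for w
      unfolding holomorphic_on_open[OF open_ball] using DERIV_szego_kernel(1)[OF _ that] by blast
  qed (rule kernel_deriv_holomorphic)
  hence "bidisc_limit (kernel_deriv \<phi> 1 0) szego_kernel_10"
    by (rule bidisc_limit_cong) (auto simp: DERIV_imp_deriv[OF DERIV_kernel_deriv] DERIV_imp_deriv[OF DERIV_szego_kernel(1)])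
  hence "bidisc_limit (\<lambda>n z w. cnj (kernel_deriv \<phi> 1 0 n w z)) (\<lambda>z w. cnj (szego_kernel_10 w z))"
    by (rule bidisc_limit_cnj_swap)
  thus 01: "bidisc_limit (kernel_deriv \<phi> 0 1) szego_kernel_01"
    by (rule bidisc_limit_cong)
       (simp_all add: kernel_deriv_cnj_swap szego_kernel_10_def szego_kernel_01_def mult_ac)
  have "bidisc_limit (\<lambda>n z w. deriv (\<lambda>z. kernel_deriv \<phi> 0 1 n z w) z) (\<lambda>z w. deriv (\<lambda>z. szego_kernel_01 z w) z)"
    using 01
  proof (rule bidisc_limit_deriv)
    show "(\<lambda>z. szego_kernel_01 z w) holomorphic_on ball 0 1" if "w \<in> ball 0 1" for w
      unfolding holomorphic_on_open[OF open_ball] using DERIV_szego_kernel(2)[OF _ that] by blast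
  qed (rule kernel_deriv_holomorphic)
  thus "bidisc_limit (kernel_deriv \<phi> 1 1) szego_kernel_11"
    by (rule bidisc_limit_cong) (auto simp: DERIV_imp_deriv[OF DERIV_kernel_deriv] DERIV_imp_deriv[OF DERIV_szego_kernel(2)])
qed

text \<open>The term with index 0 is a nonzero constant. With the diagonal bounded away from 0, the kernel values
  stay in a closed set on which the density is continuous.\<close>
lemma kernel_diag_lower_bound:
  obtains c where "c > 0" "\<And>n z. c \<le> Re (kernel \<phi> n z z)"
proof
  define d where "d = coeff (\<phi> 0) 0"
  have "\<phi> 0 = [:d:]" using degree_\<phi>[of 0] by (metis d_def degree_eq_zeroE coeff_pCons_0)
  hence \<phi>0: "poly (\<phi> 0) z = d" for z by simp
  show "(cmod d)\<^sup>2 > 0" using lead_coeff_\<phi>[of 0] by (simp add: d_def)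
  show "(cmod d)\<^sup>2 \<le> Re (kernel \<phi> n z z)" for n z
  proof -
    have "(cmod (poly (\<phi> 0) z))\<^sup>2 \<le> (\<Sum>j=0..n. (cmod (poly (\<phi> j) z))\<^sup>2)"
      by (rule member_le_sum) auto
    thus ?thesis by (simp only: kernel_diag Re_complex_of_real \<phi>0)
  qed
qed

lemma root_density_tendsto:
  assumes "r < 1"
  shows "uniform_limit (cball 0 r) (\<lambda>n z. root_density \<phi> n v z)
     (\<lambda>z. 1 / pi *
       (Re (szego_kernel_11 z z) / Re (szego_kernel z z)
        - (cmod (szego_kernel_01 z z))\<^sup>2 / (Re (szego_kernel z z))\<^sup>2
          * (1 - (cmod v)\<^sup>2 / Re (szego_kernel z z)))
       * exp (- ((cmod v)\<^sup>2 / Re (szego_kernel z z)))) sequentially"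
proof -
  obtain c where c: "c > 0" "\<And>n z. c \<le> Re (kernel \<phi> n z z)" using kernel_diag_lower_bound by blast
  define U where "U = (UNIV :: complex set) \<times> ({s. c \<le> Re s} \<times> (UNIV :: complex set))"
  define h where "h = (\<lambda>(s11::complex, s00, s01::complex). 1 / pi *
      (Re s11 / Re s00 - (cmod s01)\<^sup>2 / (Re s00)\<^sup>2 * (1 - (cmod v)\<^sup>2 / Re s00))
      * exp (- ((cmod v)\<^sup>2 / Re s00)))"
  define f where "f = (\<lambda>n z. (kernel_deriv \<phi> 1 1 n z z, kernel \<phi> n z z, kernel_deriv \<phi> 0 1 n z z))"
  define g where "g = (\<lambda>z. (szego_kernel_11 z z, szego_kernel z z, szego_kernel_01 z z))"
  have lim: "uniform_limit (cball 0 r) f g sequentially"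
    unfolding f_def g_def
    by (intro uniform_limit_Pair bidisc_limit_diag kernel_derivs_tendsto kernel_tendsto_szego_kernel assms)
  have contk: "continuous_on A (\<lambda>z. kernel_deriv \<phi> k l n z z)" for A k l n
    unfolding kernel_deriv_def by (intro continuous_intros)
  have "continuous_on (cball 0 r) g"
    by (rule uniform_limit_theorem[OF _ lim])
       (auto simp: f_def intro!: always_eventually continuous_on_Pair contk)
  hence bd: "bounded (g ` cball 0 r)" by (intro compact_imp_bounded compact_continuous_image) auto
  have "uniform_limit (cball 0 r) (\<lambda>n z. h (f n z)) (\<lambda>z. h (g z)) sequentially"
  proof (rule uniform_limit_compose_continuous[OF lim bd])
    show "closed U" unfolding U_def by (intro closed_Times closed_UNIV closed_halfspace_Re_ge)
    show "continuous_on U h"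
      unfolding h_def case_prod_unfold U_def using c(1) by (intro continuous_intros) auto
    show "f n x \<in> U" for n x using c(2) by (simp add: f_def U_def)
  qed
  thus ?thesis by (simp add: h_def f_def g_def root_density_def)
qed

end

theorem theorem6p1:
  fixes \<mu> :: "complex measure" and \<phi> :: "nat \<Rightarrow> complex poly"
    and W :: "real \<Rightarrow> real" and D :: "complex \<Rightarrow> complex" and v :: complex
  assumes "borel_prob_on_circle \<mu>"
    and "orthonormal_polys \<mu> \<phi>"
    and "szego_class \<mu> W"
    and "D = szego_function W"
  shows "locally_uniform_limit (ball 0 1)
    (\<lambda>n z. root_density \<phi> n v z)
    (\<lambda>z. 1 / pi *
       (1 / (1 - (cmod z)\<^sup>2)\<^sup>2
        + (1 - (cmod z)\<^sup>2) * (cmod (v * D z))\<^sup>2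
          * (cmod (z / complex_of_real (1 - (cmod z)\<^sup>2) - cnj (deriv D z) / cnj (D z)))\<^sup>2)
       * exp (- ((1 - (cmod z)\<^sup>2) * (cmod (v * D z))\<^sup>2)))"
proof -
  interpret szego_polys \<mu> W \<phi> using assms by unfold_locales
  let ?g = "\<lambda>z. 1 / pi *
       (1 / (1 - (cmod z)\<^sup>2)\<^sup>2
        + (1 - (cmod z)\<^sup>2) * (cmod (v * D z))\<^sup>2
          * (cmod (z / complex_of_real (1 - (cmod z)\<^sup>2) - cnj (deriv D z) / cnj (D z)))\<^sup>2)
       * exp (- ((1 - (cmod z)\<^sup>2) * (cmod (v * D z))\<^sup>2))"
  have eq: "1 / pi *
       (Re (szego_kernel_11 z z) / Re (szego_kernel z z)
        - (cmod (szego_kernel_01 z z))\<^sup>2 / (Re (szego_kernel z z))\<^sup>2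
          * (1 - (cmod v)\<^sup>2 / Re (szego_kernel z z)))
       * exp (- ((cmod v)\<^sup>2 / Re (szego_kernel z z))) = ?g z" if z: "z \<in> ball 0 1" for z
  proof -
    define p where "p = 1 - (cmod z)\<^sup>2"
    define \<beta> where "\<beta> = z / complex_of_real p - cnj (deriv D z) / cnj (D z)"
    define \<kappa> where "\<kappa> = 1 / (p * (cmod (D z))\<^sup>2)"
    have "p > 0" using z by (simp add: p_def abs_square_less_1)
    moreover have "D z \<noteq> 0" by (simp add: assms(4))
    ultimately have \<kappa>: "\<kappa> > 0" by (simp add: \<kappa>_def)
    have K: "szego_kernel z z = complex_of_real \<kappa>"
      unfolding szego_kernel_diag \<kappa>_def p_def assms(4) ..
    have K01: "cmod (szego_kernel_01 z z) = \<kappa> * cmod \<beta>"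
      using szego_kernel_diag_values(1)[OF z] \<kappa> unfolding K
      by (simp add: norm_mult \<beta>_def p_def assms(4))
    have K11: "Re (szego_kernel_11 z z) = \<kappa> * ((cmod \<beta>)\<^sup>2 + 1 / p\<^sup>2)"
      using szego_kernel_diag_values(2)[OF z] unfolding K
      by (simp add: \<beta>_def p_def assms(4))
    have V: "(cmod v)\<^sup>2 / \<kappa> = p * (cmod (v * D z))\<^sup>2"
      by (simp add: \<kappa>_def norm_mult power_mult_distrib mult_ac)
    have "\<kappa> * ((cmod \<beta>)\<^sup>2 + 1 / p\<^sup>2) / \<kappa> - (\<kappa> * cmod \<beta>)\<^sup>2 / \<kappa>\<^sup>2 * (1 - (cmod v)\<^sup>2 / \<kappa>) =
        1 / p\<^sup>2 + (cmod v)\<^sup>2 / \<kappa> * (cmod \<beta>)\<^sup>2"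
    proof -
      have "\<kappa> * x / \<kappa> = x" "(\<kappa> * x)\<^sup>2 / \<kappa>\<^sup>2 = x\<^sup>2" for x
        using \<kappa> by (simp_all add: power_mult_distrib)
      thus ?thesis by (simp only:) (simp add: algebra_simps)
    qed
    thus ?thesis
      unfolding K11 K01 K Re_complex_of_real V by (simp add: \<beta>_def p_def)
  qed
  show ?thesis unfolding locally_uniform_limit_def
  proof
    fix z :: complex assume z: "z \<in> ball 0 1"
    define r where "r = (1 + cmod z) / 2"
    have r: "cmod z < r" "r < 1" using z by (auto simp: r_def field_simps)
    have "uniform_limit (cball 0 r) (\<lambda>n z. root_density \<phi> n v z) ?g sequentially"
      using uniform_limit_cong'[THEN iffD1, OF refl eq root_density_tendsto[OF r(2), of v]] r(2) by auto
    hence "uniform_limit (ball 0 r \<inter> ball 0 1) (\<lambda>n z. root_density \<phi> n v z) ?g sequentially"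
      by (rule uniform_limit_on_subset) auto
    thus "\<exists>U. open U \<and> z \<in> U \<and> uniform_limit (U \<inter> ball 0 1) (\<lambda>n z. root_density \<phi> n v z) ?g sequentially"
      using r by (intro exI[of _ "ball 0 r"]) auto
  qed
qed

end
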